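(* Given $1 <c_1<c_2$, there exist $0< \alpha < \beta$ such that, if $m=m(n)$ satisfies $\binom{n}{2} - c_2\, n/2 \leq m \leq \binom{n}{2} - c_1\, n/2$, then $\alpha/n \leq q^*(G_{n,m}) \leq \beta/n$ with high probability.
   Context: For a graph $G=(V,E)$ with $m \geq 1$ edges, degrees $d_v$, for $A\subseteq V$ let ${\rm vol}(A)=\sum_{v\in A} d_v$ and let $e(A)$ be the number of edges with both ends in $A$. For a partition $\mathcal{A}$ of $V$, $q_{\mathcal A}(G)=\frac{1}{m}\sum_{A\in\mathcal A} e(A)-\frac{1}{4m^2}\sum_{A\in\mathcal A}{\rm vol}(A)^2$, and $q^*(G)=\max_{\mathcal A} q_{\mathcal A}(G)$. The random graph $G_{n,m}$ is sampled uniformly from all graphs on vertex set $\{1,\dots,n\}$ with exactly $m$ edges. An event holds with high probability if its probability tends to $1$ as $n\to\infty$. *)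

theory Defs
  imports "HOL-Probability.Probability" "HOL-Library.Disjoint_Sets"
begin

(* A simple graph is given by a finite vertex set V and an edge set E, a subset of
   all_edges V; edges are unordered pairs, i.e. two-element sets of vertices. *)

definition all_edges :: "'a set \<Rightarrow> 'a set set" where
  "all_edges V = {e. e \<subseteq> V \<and> card e = 2}"

definition deg :: "'a set set \<Rightarrow> 'a \<Rightarrow> nat" where
  "deg E v = card {e \<in> E. v \<in> e}"

definition vol :: "'a set set \<Rightarrow> 'a set \<Rightarrow> nat" where
  "vol E A = (\<Sum>v\<in>A. deg E v)"

definition edges_within :: "'a set set \<Rightarrow> 'a set \<Rightarrow> nat" where
  "edges_within E A = card {e \<in> E. e \<subseteq> A}"

(* Meaningful for m = card E \<ge> 1; for an edgeless graph division by zero makes it 0. *)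
definition modularity_of :: "'a set set \<Rightarrow> 'a set set \<Rightarrow> real" where
  "modularity_of E \<A> =
     1 / real (card E) * (\<Sum>A\<in>\<A>. real (edges_within E A))
     - 1 / (4 * (real (card E))\<^sup>2) * (\<Sum>A\<in>\<A>. (real (vol E A))\<^sup>2)"

(* For finite V this is the maximum of a finite nonempty set. *)
definition max_modularity :: "'a set \<Rightarrow> 'a set set \<Rightarrow> real" where
  "max_modularity V E = Max {modularity_of E \<A> | \<A>. partition_on V \<A>}"

(* The distribution of the edge set of the random graph; only meaningful for
   m \<le> n choose 2, since otherwise the underlying set is empty. *)
definition gnm :: "nat \<Rightarrow> nat \<Rightarrow> nat set set pmf" where
  "gnm n m = pmf_of_set {E. E \<subseteq> all_edges {1..n} \<and> card E = m}"

end

theory Submission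
  imports Defs
begin

text \<open>Let \<open>H\<close> be the complement graph, with \<open>n\<close> vertices and \<open>M\<close> edges. The upper bound is
  deterministic: since \<open>2 m \<le> (n - 1)\<^sup>2\<close>, a part with degree sum \<open>w\<close> in \<open>H\<close> contributes at most
  \<open>2 n\<^sup>2 w / (4 m\<^sup>2)\<close> to the modularity.

  For the lower bound, a bisection \<open>{A, V - A}\<close> cutting at least \<open>M/2 + n/4 + \<eta> n\<close> edges of \<open>H\<close> has
  modularity of order \<open>1/n\<close>. The maximum bisection of a uniformly random graph with a given number of
  edges is Lipschitz under swapping edges, so its variance is at most that number of edges; and one
  more random edge increases its mean by \<open>1/2\<close> up to a negligible error. It therefore suffices to find,
  with probability bounded away from 0, a large bisection in a graph with only \<open>(1 + \<delta>) n / 2\<close>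
  edges. There all edges can be cut except for those that closed a cycle when they were added, and the
  isolated vertices balance the cut. Edges closing cycles are rare because two random vertices are
  rarely connected: by comparison with independent edges, long paths from a vertex are as
  unlikely as long survival of a barely supercritical branching process.\<close>

section \<open>Averages over subsets of fixed size\<close>

text \<open>The term \<open>n/4\<close> is the price of balance: two halves span at most
  \<open>n^2/4\<close> crossing pairs, while \<open>m + M = n(n-1)/2\<close>, so comparing the inner
  edges of the two halves with \<open>m/2\<close> loses \<open>n/4\<close>. No cut of
  \<open>H\<close> has more than \<open>M\<close> edges, hence \<open>M > n/2\<close> is forced;
  this is where \<open>c_1 > 1\<close> enters. Beyond the critical density the mean of the maximum
  bisection grows at least as fast as \<open>M/2\<close>, up to a bounded error, so a surplus found
  at \<open>(1 + \<delta>) n/2\<close> edges persists.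

  At that point \<open>M\<close> exceeds \<open>M/2 + n/4\<close> only by
  \<open>\<delta> n/4\<close>. A loss that is merely a small multiple of \<open>n\<close> is too
  much: it has to be small compared with \<open>\<delta> n\<close>. Hence the edges are added in two
  phases. Up to \<open>(1 - \<delta>) n/2\<close> edges the process is subcritical and the chance of
  joining connected vertices is negligible even against \<open>\<delta>\<close>; afterwards only
  about \<open>\<delta> n\<close> edges follow, and a small constant chance for each is affordable.

  First moment bounds give many isolated vertices only with small positive probability.
  Concentration then serves twice: it turns this into a bound on the mean, and the mean into a bound
  that holds with high probability.\<close>

definition slice :: "'a set \<Rightarrow> nat \<Rightarrow> 'a set set" where
  "slice S m = {E. E \<subseteq> S \<and> card E = m}"

definition avg :: "'a set \<Rightarrow> nat \<Rightarrow> ('a set \<Rightarrow> real) \<Rightarrow> real" where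
  "avg S m f = (\<Sum>E\<in>slice S m. f E) / real (card S choose m)"

text \<open>The mean when every element of \<open>S\<close> is kept independently with probability
  \<open>p\<close>, written as a finite sum so that it compares directly with
  \<open>avg\<close>.\<close>

definition rnd :: "'a set \<Rightarrow> real \<Rightarrow> ('a set \<Rightarrow> real) \<Rightarrow> real" where
  "rnd S p f = (\<Sum>E\<in>Pow S. p ^ card E * (1 - p) ^ (card S - card E) * f E)"

lemma finite_slice [simp]: "finite S \<Longrightarrow> finite (slice S m)"
  unfolding slice_def by (rule finite_subset[of _ "Pow S"]) auto

lemma card_slice: "finite S \<Longrightarrow> card (slice S m) = card S choose m"
  unfolding slice_def by (rule n_subsets)

lemma slice_pos: "m \<le> card S \<Longrightarrow> 0 < real (card S choose m)"
  by simp

lemma avg_mono: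
  assumes "\<And>E. E \<in> slice S m \<Longrightarrow> f E \<le> g E"
  shows "avg S m f \<le> avg S m g"
  unfolding avg_def by (intro divide_right_mono sum_mono assms) auto

lemma avg_cong:
  assumes "\<And>E. E \<in> slice S m \<Longrightarrow> f E = g E"
  shows "avg S m f = avg S m g"
  unfolding avg_def using assms by (simp cong: sum.cong)

lemma avg_add: "avg S m (\<lambda>E. f E + g E) = avg S m f + avg S m g"
  by (simp add: avg_def sum.distrib add_divide_distrib)

lemma avg_cmult: "avg S m (\<lambda>E. c * f E) = c * avg S m f"
  by (simp add: avg_def sum_distrib_left)

lemma avg_const:
  assumes "finite S" "m \<le> card S"
  shows "avg S m (\<lambda>_. c) = c"
  using slice_pos[OF assms(2)] by (simp add: avg_def card_slice[OF assms(1)])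

lemma avg_nonneg: "(\<And>E. E \<in> slice S m \<Longrightarrow> 0 \<le> f E) \<Longrightarrow> 0 \<le> avg S m f"
  unfolding avg_def by (intro divide_nonneg_nonneg sum_nonneg) auto

section \<open>Building a random set one element at a time\<close>

lemma sum_slice_Suc:
  fixes f :: "'a set \<Rightarrow> real"
  assumes "finite S"
  shows "real (Suc m) * (\<Sum>E\<in>slice S (Suc m). f E) = (\<Sum>E\<in>slice S m. \<Sum>e\<in>S - E. f (insert e E))"
proof -
  have fin: "finite E" if "E \<subseteq> S" for E using that assms finite_subset by blast
  have "real (Suc m) * (\<Sum>E\<in>slice S (Suc m). f E) = (\<Sum>E\<in>slice S (Suc m). \<Sum>e\<in>E. f E)"
    by (simp add: sum_distrib_left slice_def)
  also have "\<dots> = (\<Sum>(E, e)\<in>(SIGMA E:slice S (Suc m). E). f E)"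
    using assms fin by (subst sum.Sigma) (auto simp: slice_def)
  also have "\<dots> = (\<Sum>(E, e)\<in>(SIGMA E:slice S m. S - E). f (insert e E))"
    by (rule sum.reindex_bij_witness[of _ "\<lambda>(E, e). (insert e E, e)" "\<lambda>(E, e). (E - {e}, e)"])
       (auto simp: slice_def insert_absorb card_insert_if fin card_Diff_singleton)
  also have "\<dots> = (\<Sum>E\<in>slice S m. \<Sum>e\<in>S - E. f (insert e E))"
    using assms by (subst sum.Sigma) auto
  finally show ?thesis .
qed

text \<open>The double count of pairs \<open>(E, e)\<close> once more, now grouped by the element.
  Grouping by the set describes adding a last element, which controls how means grow with the size;
  grouping by the element describes revealing a first one, which drives the variance bound.\<close>

lemma sum_slice_pick:
  fixes f :: "'a set \<Rightarrow> real"
  assumes "finite S"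
  shows "real (Suc m) * (\<Sum>E\<in>slice S (Suc m). f E)
    = (\<Sum>e\<in>S. \<Sum>E\<in>slice (S - {e}) m. f (insert e E))"
proof -
  have "(\<Sum>E\<in>slice S m. \<Sum>e\<in>S - E. f (insert e E))
      = (\<Sum>(E, e)\<in>(SIGMA E:slice S m. S - E). f (insert e E))"
    using assms by (subst sum.Sigma) auto
  also have "\<dots> = (\<Sum>(e, E)\<in>(SIGMA e:S. slice (S - {e}) m). f (insert e E))"
    by (rule sum.reindex_bij_witness[of _ "\<lambda>(E, e). (e, E)" "\<lambda>(E, e). (e, E)"])
       (auto simp: slice_def)
  also have "\<dots> = (\<Sum>e\<in>S. \<Sum>E\<in>slice (S - {e}) m. f (insert e E))"
    using assms by (subst sum.Sigma) auto
  finally show ?thesis using sum_slice_Suc[OF assms, of m f] by simp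
qed

lemma choose_Suc_real:
  assumes "m \<le> N"
  shows "real (Suc m) * real (N choose Suc m) = real (N - m) * real (N choose m)"
  using assms by (metis binomial_absorb_comp binomial_absorption of_nat_mult)

lemma avg_Suc:
  assumes "finite S" "m < card S"
  shows "avg S (Suc m) f = avg S m (\<lambda>E. (\<Sum>e\<in>S - E. f (insert e E)) / real (card S - m))"
proof -
  let ?N = "card S"
  have N: "real (Suc m) * real (?N choose Suc m) = real (?N - m) * real (?N choose m)"
    using assms by (intro choose_Suc_real) auto
  have pos: "real (?N choose Suc m) > 0" "real (?N choose m) > 0" "real (?N - m) > 0"
    using assms by auto
  have "avg S (Suc m) f
      = (real (Suc m) * (\<Sum>E\<in>slice S (Suc m). f E)) / (real (Suc m) * real (?N choose Suc m))"
    unfolding avg_def by (subst mult_divide_mult_cancel_left) auto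
  also have "\<dots> = (\<Sum>E\<in>slice S m. \<Sum>e\<in>S - E. f (insert e E)) / (real (?N - m) * real (?N choose m))"
    by (simp only: N sum_slice_Suc[OF assms(1)])
  also have "\<dots> = avg S m (\<lambda>E. (\<Sum>e\<in>S - E. f (insert e E)) / real (?N - m))"
    unfolding avg_def by (simp add: sum_divide_distrib[symmetric])
  finally show ?thesis .
qed

lemma avg_pick:
  assumes "finite S" "m < card S"
  shows "avg S (Suc m) f = (\<Sum>e\<in>S. avg (S - {e}) m (\<lambda>E. f (insert e E))) / real (card S)"
proof -
  let ?N = "card S"
  have N: "real (Suc m) * real (?N choose Suc m) = real ?N * real ((?N - 1) choose m)"
    using assms binomial_absorption[of m "?N"] by (metis of_nat_mult)
  have "avg S (Suc m) f
      = (real (Suc m) * (\<Sum>E\<in>slice S (Suc m). f E)) / (real (Suc m) * real (?N choose Suc m))"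
    unfolding avg_def by (subst mult_divide_mult_cancel_left) auto
  also have "\<dots> = (\<Sum>e\<in>S. \<Sum>E\<in>slice (S - {e}) m. f (insert e E)) / (real ?N * real ((?N - 1) choose m))"
    by (simp only: N sum_slice_pick[OF assms(1)])
  also have "\<dots> = (\<Sum>e\<in>S. avg (S - {e}) m (\<lambda>E. f (insert e E))) / real ?N"
    unfolding avg_def using assms(1)
    by (simp add: sum_divide_distrib[symmetric] card_Diff_singleton cong: sum.cong)
  finally show ?thesis .
qed

definition incr_on :: "'a set \<Rightarrow> ('a set \<Rightarrow> real) \<Rightarrow> bool" where
  "incr_on S f \<longleftrightarrow> (\<forall>E F. E \<subseteq> F \<longrightarrow> F \<subseteq> S \<longrightarrow> f E \<le> f F)"

lemma incr_onD: "incr_on S f \<Longrightarrow> E \<subseteq> F \<Longrightarrow> F \<subseteq> S \<Longrightarrow> f E \<le> f F"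
  by (simp add: incr_on_def)

lemma avg_mono_size:
  assumes "finite S" "incr_on S f" "m \<le> m'" "m' \<le> card S"
  shows "avg S m f \<le> avg S m' f"
  using assms(3,4)
proof (induction m' rule: dec_induct)
  case (step k)
  have k: "k < card S" using step.prems by simp
  have "avg S k f \<le> avg S k (\<lambda>E. (\<Sum>e\<in>S - E. f (insert e E)) / real (card S - k))"
  proof (rule avg_mono)
    fix E assume E: "E \<in> slice S k"
    have "finite E" using E finite_subset[OF _ assms(1)] by (simp add: slice_def)
    hence "real (card S - k) * f E = (\<Sum>e\<in>S - E. f E)"
      using E by (simp add: slice_def card_Diff_subset)
    also have "\<dots> \<le> (\<Sum>e\<in>S - E. f (insert e E))"
    proof (intro sum_mono)
      fix e assume "e \<in> S - E"
      hence "insert e E \<subseteq> S" using E by (auto simp: slice_def)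
      thus "f E \<le> f (insert e E)" by (intro incr_onD[OF assms(2)]) auto
    qed
    finally show "f E \<le> (\<Sum>e\<in>S - E. f (insert e E)) / real (card S - k)"
      using k by (subst pos_le_divide_eq) (auto simp: mult.commute)
  qed
  also have "\<dots> = avg S (Suc k) f" by (rule avg_Suc[OF assms(1) k, symmetric])
  finally show ?case using step.IH k by linarith
qed simp

section \<open>Concentration for functions that change little under a swap\<close>

definition swap_lipschitz :: "'a set \<Rightarrow> real \<Rightarrow> ('a set \<Rightarrow> real) \<Rightarrow> bool" where
  "swap_lipschitz S C f \<longleftrightarrow>
    (\<forall>E a b. E \<subseteq> S \<longrightarrow> a \<in> S - E \<longrightarrow> b \<in> S - E \<longrightarrow> \<bar>f (insert a E) - f (insert b E)\<bar> \<le> C)"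

lemma swap_lipschitzD:
  assumes "swap_lipschitz S C f" "E \<subseteq> S" "a \<in> S - E" "b \<in> S - E"
  shows "\<bar>f (insert a E) - f (insert b E)\<bar> \<le> C"
  using assms unfolding swap_lipschitz_def by blast

text \<open>A coupling: exchanging \<open>b\<close> for \<open>a\<close> is a bijection from the
  \<open>m\<close>-subsets of \<open>S - {a}\<close> to those of \<open>S - {b}\<close>. If
  \<open>b\<close> is in \<open>E\<close>, both completed sets agree; otherwise they differ by one
  swap.\<close>

lemma avg_insert_le:
  assumes S: "finite S" and L: "swap_lipschitz S C f" and C: "0 \<le> C"
    and ab: "a \<in> S" "b \<in> S" and m: "m < card S"
  shows "avg (S - {a}) m (\<lambda>E. f (insert a E)) \<le> avg (S - {b}) m (\<lambda>E. f (insert b E)) + C"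
proof (cases "a = b")
  case False
  define \<pi> where "\<pi> E = (if b \<in> E then insert a (E - {b}) else E)" for E
  define \<pi>' where "\<pi>' E = (if a \<in> E then insert b (E - {a}) else E)" for E
  have fin: "finite E" if "E \<subseteq> S" for E using that S finite_subset by blast
  have Suc_pred': "Suc (card E - Suc 0) = card E" if "E \<subseteq> S" "x \<in> E" for E x
    using that fin[of E] by (metis card_Suc_Diff1 card_Diff_singleton One_nat_def)
  have re: "(\<Sum>E\<in>slice (S - {a}) m. f (insert b (\<pi> E))) = (\<Sum>E\<in>slice (S - {b}) m. f (insert b E))"
    using False ab
    by (intro sum.reindex_bij_witness[of _ \<pi>' \<pi>])
       (auto simp: \<pi>_def \<pi>'_def slice_def card_insert_if fin subset_Diff_insert Suc_pred'
         split: if_splits)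
  have le: "f (insert a E) \<le> f (insert b (\<pi> E)) + C" if E: "E \<in> slice (S - {a}) m" for E
  proof (cases "b \<in> E")
    case True
    hence "insert b (\<pi> E) = insert a E" using False by (auto simp: \<pi>_def)
    thus ?thesis using C by simp
  next
    case False
    hence "\<bar>f (insert a E) - f (insert b E)\<bar> \<le> C"
      using E ab by (intro swap_lipschitzD[OF L]) (auto simp: slice_def)
    thus ?thesis using False by (simp add: \<pi>_def abs_le_iff)
  qed
  have "avg (S - {a}) m (\<lambda>E. f (insert a E)) \<le> avg (S - {a}) m (\<lambda>E. f (insert b (\<pi> E)) + C)"
    by (rule avg_mono) (rule le)
  also have "\<dots> = avg (S - {a}) m (\<lambda>E. f (insert b (\<pi> E))) + C"
    using S ab m by (subst avg_add, subst avg_const) (auto simp: card_Diff_singleton)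
  also have "avg (S - {a}) m (\<lambda>E. f (insert b (\<pi> E))) = avg (S - {b}) m (\<lambda>E. f (insert b E))"
    using ab S by (simp add: avg_def re card_Diff_singleton)
  finally show ?thesis .
qed (use C in simp)

text \<open>Revealing one element \<open>e\<close> splits the variance into the mean of the
  conditional variances, bounded by induction, and the variance of the conditional means
  \<open>\<nu> e\<close>. By the coupling these means differ pairwise by at most \<open>C\<close>,
  so each lies within \<open>C\<close> of the overall mean. This is the second moment form of the
  bounded differences method for sampling without replacement.\<close>

lemma avg_variance_le:
  assumes "finite S" "swap_lipschitz S C f" "0 \<le> C" "m \<le> card S"
  shows "avg S m (\<lambda>E. (f E - avg S m f)\<^sup>2) \<le> real m * C\<^sup>2"
  using assms
proof (induction m arbitrary: S f)
  case 0
  have "slice S 0 = {{}}"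
    using 0(1) by (auto simp: slice_def dest: finite_subset)
  thus ?case by (simp add: avg_def)
next
  case (Suc m)
  let ?N = "card S" and ?\<mu> = "avg S (Suc m) f"
  define \<nu> where "\<nu> e = avg (S - {e}) m (\<lambda>E. f (insert e E))" for e
  have m: "m < ?N" using Suc by simp
  hence N: "real ?N > 0" by simp
  have \<mu>: "?\<mu> = (\<Sum>e\<in>S. \<nu> e) / real ?N"
    using avg_pick[OF Suc.prems(1) m] by (simp add: \<nu>_def)
  have one: "avg (S - {e}) m (\<lambda>E. (f (insert e E) - ?\<mu>)\<^sup>2) \<le> real m * C\<^sup>2 + C\<^sup>2" if e: "e \<in> S" for e
  proof -
    have "\<nu> e * real ?N \<le> (\<Sum>b\<in>S. \<nu> b + C)"
      using sum_mono[of S "\<lambda>_. \<nu> e" "\<lambda>b. \<nu> b + C"]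
        avg_insert_le[OF Suc.prems(1-3) e _ m] by (simp add: \<nu>_def mult.commute)
    hence a1: "\<nu> e \<le> ?\<mu> + C" using N unfolding \<mu> by (simp add: sum.distrib field_simps)
    have "(\<Sum>b\<in>S. \<nu> b) \<le> (\<Sum>b\<in>S. \<nu> e + C)"
      by (intro sum_mono) (use avg_insert_le[OF Suc.prems(1-3) _ e m] in \<open>simp add: \<nu>_def\<close>)
    hence a2: "?\<mu> \<le> \<nu> e + C" using N unfolding \<mu> by (simp add: sum.distrib field_simps)
    have sq: "(\<nu> e - ?\<mu>)\<^sup>2 \<le> C\<^sup>2"
      using a1 a2 by (intro power2_le_iff_abs_le[THEN iffD2]) (auto simp: Suc.prems abs_le_iff)
    have L: "swap_lipschitz (S - {e}) C (\<lambda>E. f (insert e E))"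
      unfolding swap_lipschitz_def
    proof (intro allI impI)
      fix E a b assume "E \<subseteq> S - {e}" "a \<in> S - {e} - E" "b \<in> S - {e} - E"
      hence "\<bar>f (insert a (insert e E)) - f (insert b (insert e E))\<bar> \<le> C"
        using e by (intro swap_lipschitzD[OF Suc.prems(2)]) auto
      thus "\<bar>f (insert e (insert a E)) - f (insert e (insert b E))\<bar> \<le> C"
        by (simp add: insert_commute)
    qed
    have cS: "finite (S - {e})" "m \<le> card (S - {e})" using Suc.prems e by auto
    have "avg (S - {e}) m (\<lambda>E. (f (insert e E) - \<nu> e)\<^sup>2) \<le> real m * C\<^sup>2"
      using Suc.IH[OF cS(1) L Suc.prems(3) cS(2)] by (simp add: \<nu>_def)
    \<comment> \<open>Expansion around the conditional mean: the linear term averages to zero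
      because \<open>\<nu> e\<close> is the mean of \<open>f (insert e E)\<close>.\<close>
    moreover have "avg (S - {e}) m (\<lambda>E. (f (insert e E) - ?\<mu>)\<^sup>2)
       = avg (S - {e}) m (\<lambda>E. (f (insert e E) - \<nu> e)\<^sup>2 + (2 * (\<nu> e - ?\<mu>) * f (insert e E)
           + ((\<nu> e - ?\<mu>)\<^sup>2 - 2 * (\<nu> e - ?\<mu>) * \<nu> e)))"
      by (rule avg_cong) (simp add: power2_eq_square algebra_simps)
    moreover have "\<dots> = avg (S - {e}) m (\<lambda>E. (f (insert e E) - \<nu> e)\<^sup>2) + (\<nu> e - ?\<mu>)\<^sup>2"
      unfolding avg_add avg_cmult avg_const[OF cS] by (simp add: \<nu>_def)
    ultimately show ?thesis using sq by linarith
  qed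
  have "avg S (Suc m) (\<lambda>E. (f E - ?\<mu>)\<^sup>2)
      = (\<Sum>e\<in>S. avg (S - {e}) m (\<lambda>E. (f (insert e E) - ?\<mu>)\<^sup>2)) / real ?N"
    by (rule avg_pick[OF Suc.prems(1) m])
  also have "\<dots> \<le> (\<Sum>e\<in>S. real m * C\<^sup>2 + C\<^sup>2) / real ?N"
    using one by (intro divide_right_mono sum_mono) auto
  also have "\<dots> = real (Suc m) * C\<^sup>2" using N by (simp add: field_simps)
  finally show ?case .
qed

definition share :: "'a set \<Rightarrow> nat \<Rightarrow> ('a set \<Rightarrow> bool) \<Rightarrow> real" where
  "share S m P = avg S m (\<lambda>E. of_bool (P E))"

lemma share_markov:
  assumes "finite S" "\<And>E. E \<in> slice S m \<Longrightarrow> 0 \<le> f E" "0 < t"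
    "\<And>E. E \<in> slice S m \<Longrightarrow> P E \<Longrightarrow> t \<le> f E"
  shows "share S m P \<le> avg S m f / t"
proof -
  have "share S m P \<le> avg S m (\<lambda>E. (1 / t) * f E)"
    unfolding share_def
    by (rule avg_mono) (use assms in \<open>auto simp: of_bool_def field_simps\<close>)
  thus ?thesis unfolding avg_cmult by simp
qed

lemma share_chebyshev:
  assumes "finite S" "swap_lipschitz S C f" "0 \<le> C" "m \<le> card S" "0 < t"
  shows "share S m (\<lambda>E. t \<le> \<bar>f E - avg S m f\<bar>) \<le> real m * C\<^sup>2 / t\<^sup>2"
proof -
  have "share S m (\<lambda>E. t \<le> \<bar>f E - avg S m f\<bar>) \<le> avg S m (\<lambda>E. (f E - avg S m f)\<^sup>2) / t\<^sup>2"
    using assms(1,5) abs_le_square_iff[of t] by (intro share_markov) auto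
  also have "\<dots> \<le> real m * C\<^sup>2 / t\<^sup>2"
    by (intro divide_right_mono avg_variance_le assms) auto
  finally show ?thesis .
qed

section \<open>Comparison with independently chosen elements\<close>

lemma rnd_eq_sum_avg:
  assumes "finite S"
  shows "rnd S p f = (\<Sum>k\<le>card S. Bernstein (card S) k p * avg S k f)"
proof -
  have "rnd S p f = (\<Sum>k\<le>card S. \<Sum>E\<in>{E \<in> Pow S. card E = k}.
      p ^ card E * (1 - p) ^ (card S - card E) * f E)"
    unfolding rnd_def by (rule sum.group[symmetric]) (auto simp: assms card_mono)
  also have "\<dots> = (\<Sum>k\<le>card S. Bernstein (card S) k p * avg S k f)"
  proof (rule sum.cong)
    fix k assume k: "k \<in> {..card S}"
    have "{E \<in> Pow S. card E = k} = slice S k" by (auto simp: slice_def)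
    moreover have "real (card S choose k) \<noteq> 0" using k by simp
    ultimately show "(\<Sum>E\<in>{E \<in> Pow S. card E = k}. p ^ card E * (1 - p) ^ (card S - card E) * f E)
        = Bernstein (card S) k p * avg S k f"
      by (simp add: avg_def Bernstein_def sum_distrib_left[symmetric] slice_def)
  qed simp
  finally show ?thesis .
qed

text \<open>The size of the independent random set is binomial, with weights
  \<open>Bernstein (card S) k p\<close>. By Chebyshev it falls below \<open>m\<close> with
  probability at most the subtracted quotient, and at every size from \<open>m\<close> on an
  increasing \<open>f\<close> has at least the mean it has at \<open>m\<close>.\<close>

lemma avg_le_rnd:
  assumes S: "finite S" and f: "incr_on S f" "\<And>E. E \<subseteq> S \<Longrightarrow> 0 \<le> f E"
    and p: "0 \<le> p" "p \<le> 1" and m: "real m < real (card S) * p"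
  shows "avg S m f * (1 - real (card S) * p / (real (card S) * p - real m)\<^sup>2) \<le> rnd S p f"
proof -
  let ?N = "card S"
  let ?B = "\<lambda>k. Bernstein ?N k p"
  have B0: "0 \<le> ?B k" for k using p by (simp add: Bernstein_nonneg)
  have "real m \<le> real ?N" using m p mult_left_le[of p "real ?N"] by linarith
  hence mN: "m \<le> ?N" by simp
  have var: "(\<Sum>k\<le>?N. ?B k * (real k - real ?N * p)\<^sup>2) = real ?N * p * (1 - p)"
  proof -
    have "(\<Sum>k\<le>?N. ?B k * (real k - real ?N * p)\<^sup>2)
      = (\<Sum>k\<le>?N. real k * (real k - 1) * ?B k) + (1 - 2 * real ?N * p) * (\<Sum>k\<le>?N. real k * ?B k)
        + (real ?N * p)\<^sup>2 * (\<Sum>k\<le>?N. ?B k)"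
      unfolding sum_distrib_left sum.distrib[symmetric]
      by (rule sum.cong) (auto simp: power2_eq_square algebra_simps)
    also have "\<dots> = real ?N * (real ?N - 1) * p\<^sup>2 + (1 - 2 * real ?N * p) * (real ?N * p) + (real ?N * p)\<^sup>2"
      by (simp add: sum_kk_Bernstein sum_k_Bernstein sum_Bernstein)
    also have "\<dots> = real ?N * p * (1 - p)" by (simp add: power2_eq_square algebra_simps)
    finally show ?thesis .
  qed
  have tail: "(\<Sum>k<m. ?B k) * (real ?N * p - real m)\<^sup>2 \<le> real ?N * p"
  proof -
    have "(\<Sum>k<m. ?B k) * (real ?N * p - real m)\<^sup>2 \<le> (\<Sum>k<m. ?B k * (real k - real ?N * p)\<^sup>2)"
      unfolding sum_distrib_right
    proof (intro sum_mono mult_left_mono B0)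
      fix k assume "k \<in> {..<m}"
      thus "(real ?N * p - real m)\<^sup>2 \<le> (real k - real ?N * p)\<^sup>2"
        using m by (intro abs_le_square_iff[THEN iffD1]) auto
    qed
    also have "\<dots> \<le> (\<Sum>k\<le>?N. ?B k * (real k - real ?N * p)\<^sup>2)"
      using mN by (intro sum_mono2) (auto simp: B0)
    also have "\<dots> \<le> real ?N * p" unfolding var using p mult_left_le[of "1 - p" "real ?N * p"] by simp
    finally show ?thesis .
  qed
  have split: "{..?N} = {..<m} \<union> {m..?N}" using mN by auto
  have one: "(\<Sum>k<m. ?B k) + (\<Sum>k=m..?N. ?B k) = 1"
    using sum_Bernstein[of ?N p] unfolding split by (subst (asm) sum.union_disjoint) auto
  have a0: "0 \<le> avg S k f" for k by (rule avg_nonneg) (use f in \<open>auto simp: slice_def\<close>)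
  have d: "(real ?N * p - real m)\<^sup>2 > 0" using m by simp
  have "1 - real ?N * p / (real ?N * p - real m)\<^sup>2 \<le> (\<Sum>k=m..?N. ?B k)"
  proof -
    have "(\<Sum>k<m. ?B k) \<le> real ?N * p / (real ?N * p - real m)\<^sup>2"
      using tail d by (simp add: pos_le_divide_eq)
    thus ?thesis using one by linarith
  qed
  hence "avg S m f * (1 - real ?N * p / (real ?N * p - real m)\<^sup>2) \<le> (\<Sum>k=m..?N. ?B k * avg S m f)"
    unfolding sum_distrib_right[symmetric] by (subst mult.commute) (rule mult_right_mono[OF _ a0])
  also have "\<dots> \<le> (\<Sum>k=m..?N. ?B k * avg S k f)"
    using avg_mono_size[OF S f(1)] by (intro sum_mono mult_left_mono B0) auto
  also have "\<dots> \<le> (\<Sum>k\<le>?N. ?B k * avg S k f)"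
    using a0 B0 by (intro sum_mono2) auto
  finally show ?thesis using rnd_eq_sum_avg[OF S] by simp
qed

lemma rnd_const: "finite S \<Longrightarrow> rnd S p (\<lambda>_. c) = c"
proof -
  assume S: "finite S"
  have "rnd S p (\<lambda>_. c) = (\<Sum>k\<le>card S. Bernstein (card S) k p * c)"
    unfolding rnd_eq_sum_avg[OF S] by (intro sum.cong) (auto simp: avg_const[OF S])
  thus ?thesis by (simp add: sum_distrib_right[symmetric] sum_Bernstein)
qed

lemma rnd_add: "rnd S p (\<lambda>E. f E + g E) = rnd S p f + rnd S p g"
  by (simp add: rnd_def sum.distrib algebra_simps)

lemma rnd_cmult: "rnd S p (\<lambda>E. c * f E) = c * rnd S p f"
  by (simp add: rnd_def sum_distrib_left algebra_simps)

lemma rnd_sum: "rnd S p (\<lambda>E. \<Sum>i\<in>I. f i E) = (\<Sum>i\<in>I. rnd S p (f i))"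
  unfolding rnd_def sum_distrib_left by (rule sum.swap)

lemma rnd_mono:
  assumes "0 \<le> p" "p \<le> 1" "\<And>E. E \<subseteq> S \<Longrightarrow> f E \<le> g E"
  shows "rnd S p f \<le> rnd S p g"
  unfolding rnd_def using assms by (intro sum_mono mult_left_mono) auto

lemma rnd_cong: "(\<And>E. E \<subseteq> S \<Longrightarrow> f E = g E) \<Longrightarrow> rnd S p f = rnd S p g"
  unfolding rnd_def by (intro sum.cong) auto

lemma rnd_Un:
  assumes "finite S" "finite T" "S \<inter> T = {}"
  shows "rnd (S \<union> T) p f = rnd S p (\<lambda>E. rnd T p (\<lambda>F. f (E \<union> F)))"
proof -
  have "rnd S p (\<lambda>E. rnd T p (\<lambda>F. f (E \<union> F)))
    = (\<Sum>(E, F)\<in>Pow S \<times> Pow T. p ^ card E * (1 - p) ^ (card S - card E) *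
        (p ^ card F * (1 - p) ^ (card T - card F) * f (E \<union> F)))"
    unfolding rnd_def sum_distrib_left using assms by (subst sum.cartesian_product) auto
  also have "\<dots> = (\<Sum>E\<in>Pow (S \<union> T). p ^ card E * (1 - p) ^ (card (S \<union> T) - card E) * f E)"
  proof (rule sum.reindex_bij_witness[of _ "\<lambda>E. (E \<inter> S, E \<inter> T)" "\<lambda>(E, F). E \<union> F"], goal_cases)
    case (5 a)
    obtain E F where a: "a = (E, F)" "E \<subseteq> S" "F \<subseteq> T" using 5 by auto
    have fin: "finite E" "finite F" using a assms finite_subset by blast+
    have c: "card (E \<union> F) = card E + card F"
      using a assms fin by (intro card_Un_disjoint) auto
    have "card E \<le> card S" "card F \<le> card T" using a assms by (auto intro: card_mono)
    hence "card S + card T - (card E + card F) = (card S - card E) + (card T - card F)" by simp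
    thus ?case using a c card_Un_disjoint[OF assms] by (simp add: power_add algebra_simps)
  qed (use assms in auto)
  finally show ?thesis by (simp add: rnd_def)
qed

text \<open>The tangent of \<open>exp\<close> at the mean lies below \<open>exp\<close>; averaging
  the tangent gives its value at the mean.\<close>

lemma jensen_exp_rnd:
  assumes "finite S" "0 \<le> p" "p \<le> 1"
  shows "exp (rnd S p f) \<le> rnd S p (\<lambda>E. exp (f E))"
proof -
  let ?\<mu> = "rnd S p f"
  have "rnd S p (\<lambda>E. exp ?\<mu> * f E + exp ?\<mu> * (1 - ?\<mu>)) \<le> rnd S p (\<lambda>E. exp (f E))"
  proof (rule rnd_mono[OF assms(2,3)])
    fix E
    have "exp ?\<mu> * (1 + (f E - ?\<mu>)) \<le> exp ?\<mu> * exp (f E - ?\<mu>)"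
      by (intro mult_left_mono exp_ge_add_one_self) auto
    thus "exp ?\<mu> * f E + exp ?\<mu> * (1 - ?\<mu>) \<le> exp (f E)"
      by (simp add: exp_add[symmetric] algebra_simps)
  qed
  thus ?thesis unfolding rnd_add rnd_cmult rnd_const[OF assms(1)] by (simp add: algebra_simps)
qed

section \<open>Paths in random graphs\<close>

lemma rnd_of_bool_disjoint:
  assumes "finite S" "T \<subseteq> S"
  shows "rnd S p (\<lambda>E. of_bool (E \<inter> T = {})) = (1 - p) ^ card T"
proof -
  have T: "finite T" using assms finite_subset by blast
  have "rnd T p (\<lambda>E. of_bool (E = {})) = (\<Sum>E\<in>{{}}. (1 - p) ^ card T)"
    unfolding rnd_def using T by (subst sum.mono_neutral_right[of _ "{{}}"]) auto
  hence "rnd T p (\<lambda>E. of_bool (E = {})) = (1 - p) ^ card T" by simp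
  moreover have "rnd S p (\<lambda>E. of_bool (E \<inter> T = {})) = rnd (T \<union> (S - T)) p (\<lambda>E. of_bool (E \<inter> T = {}))"
    using assms by (simp add: Un_absorb1)
  moreover have "\<dots> = rnd T p (\<lambda>E. rnd (S - T) p (\<lambda>F. of_bool ((E \<union> F) \<inter> T = {})))"
    using assms T by (intro rnd_Un) auto
  moreover have "\<dots> = rnd T p (\<lambda>E. rnd (S - T) p (\<lambda>F. of_bool (E = {})))"
    by (intro rnd_cong) (auto intro!: arg_cong[where f = of_bool])
  ultimately show ?thesis using assms by (simp add: rnd_const)
qed

lemma rnd_of_bool_mem:
  assumes "finite S" "e \<in> S"
  shows "rnd S p (\<lambda>E. of_bool (e \<in> E)) = p"
proof -
  have "rnd S p (\<lambda>E. of_bool (e \<in> E)) = rnd S p (\<lambda>E. 1 + (- 1) * of_bool (E \<inter> {e} = {}))"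
    by (rule rnd_cong) auto
  also have "\<dots> = 1 + (- 1) * (1 - p) ^ card {e}"
    unfolding rnd_add rnd_cmult using assms
    by (subst rnd_of_bool_disjoint) (auto simp: rnd_const)
  finally show ?thesis by simp
qed

lemma sum_of_bool_card: "finite A \<Longrightarrow> (\<Sum>x\<in>A. of_bool (P x)) = real (card {x\<in>A. P x})"
  by (simp add: sum_of_bool_eq Collect_conj_eq)

lemma finite_all_edges [simp]: "finite V \<Longrightarrow> finite (all_edges V)"
  unfolding all_edges_def by (rule finite_subset[of _ "Pow V"]) auto

lemma card_all_edges: "finite V \<Longrightarrow> card (all_edges V) = card V choose 2"
  unfolding all_edges_def by (rule n_subsets)

section \<open>Exposing the edges at one vertex\<close>

definition star :: "'a set \<Rightarrow> 'a \<Rightarrow> 'a set set" where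
  "star V u = (\<lambda>v. {u, v}) ` (V - {u})"

lemma all_edges_star:
  assumes "u \<in> V"
  shows "all_edges V = all_edges (V - {u}) \<union> star V u" "all_edges (V - {u}) \<inter> star V u = {}"
proof -
  show "all_edges V = all_edges (V - {u}) \<union> star V u"
  proof (intro set_eqI iffI)
    fix e assume e: "e \<in> all_edges V"
    show "e \<in> all_edges (V - {u}) \<union> star V u"
    proof (cases "u \<in> e")
      case True
      then obtain v where "e = {u, v}" "v \<noteq> u"
        using e unfolding all_edges_def card_2_iff by auto
      thus ?thesis using e by (auto simp: star_def all_edges_def)
    qed (use e in \<open>auto simp: all_edges_def\<close>)
  next
    fix e assume "e \<in> all_edges (V - {u}) \<union> star V u"
    thus "e \<in> all_edges V" using assms by (auto simp: star_def all_edges_def card_2_iff)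
  qed
qed (auto simp: star_def all_edges_def)

lemma rnd_all_edges_star:
  assumes "finite V" "u \<in> V"
  shows "rnd (all_edges V) p f
    = rnd (all_edges (V - {u})) p (\<lambda>E. rnd (star V u) p (\<lambda>F. f (E \<union> F)))"
proof -
  have "finite (star V u)" using assms by (simp add: star_def)
  thus ?thesis using all_edges_star[OF assms(2)] assms(1) by (simp add: rnd_Un)
qed

text \<open>Deleting \<open>u\<close> at each step makes the paths self-avoiding, and the recursive
  call then asks only about edges that avoid \<open>u\<close>. These are independent of the star at
  \<open>u\<close>, so the probability can be computed by recursion.\<close>

primrec path_from :: "nat \<Rightarrow> 'a set \<Rightarrow> 'a set set \<Rightarrow> 'a \<Rightarrow> bool" where
  "path_from 0 V E u \<longleftrightarrow> u \<in> V"
| "path_from (Suc k) V E u \<longleftrightarrow>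
    u \<in> V \<and> (\<exists>v\<in>V - {u}. {u, v} \<in> E \<and> path_from k (V - {u}) E v)"

primrec path_to :: "nat \<Rightarrow> 'a set \<Rightarrow> 'a set set \<Rightarrow> 'a \<Rightarrow> 'a \<Rightarrow> bool" where
  "path_to 0 V E u w \<longleftrightarrow> u \<in> V \<and> w = u"
| "path_to (Suc k) V E u w \<longleftrightarrow>
    u \<in> V \<and> (\<exists>v\<in>V - {u}. {u, v} \<in> E \<and> path_to k (V - {u}) E v w)"

lemma path_from_cong:
  "E \<inter> Pow V = F \<inter> Pow V \<Longrightarrow> path_from k V E u = path_from k V F u"
proof (induction k arbitrary: V u)
  case (Suc k)
  have "E \<inter> Pow (V - {u}) = F \<inter> Pow (V - {u})" using Suc.prems by blast
  hence IH: "path_from k (V - {u}) E v = path_from k (V - {u}) F v" for v by (rule Suc.IH)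
  have "{u, v} \<in> E \<longleftrightarrow> {u, v} \<in> F" if "u \<in> V" "v \<in> V" for v using Suc.prems that by blast
  thus ?case using IH by auto
qed simp

lemma path_to_cong:
  "E \<inter> Pow V = F \<inter> Pow V \<Longrightarrow> path_to k V E u w = path_to k V F u w"
proof (induction k arbitrary: V u)
  case (Suc k)
  have "E \<inter> Pow (V - {u}) = F \<inter> Pow (V - {u})" using Suc.prems by blast
  hence IH: "path_to k (V - {u}) E v w = path_to k (V - {u}) F v w" for v by (rule Suc.IH)
  have "{u, v} \<in> E \<longleftrightarrow> {u, v} \<in> F" if "u \<in> V" "v \<in> V" for v using Suc.prems that by blast
  thus ?case using IH by auto
qed simp

lemma path_to_subset: "path_to k V E u w \<Longrightarrow> w \<in> V"
  by (induction k arbitrary: V u) auto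

lemma path_to_imp_path_from: "path_to k V E u w \<Longrightarrow> j \<le> k \<Longrightarrow> path_from j V E u"
proof (induction k arbitrary: V u j)
  case (Suc k)
  thus ?case by (cases j) auto
qed auto

text \<open>Survival to generation \<open>k\<close> of a branching process with Poisson offspring of mean \<open>l\<close>.\<close>

primrec surv :: "real \<Rightarrow> nat \<Rightarrow> real" where
  "surv l 0 = 1"
| "surv l (Suc k) = 1 - exp (- (l * surv l k))"

lemma surv_bounds: "0 \<le> l \<Longrightarrow> 0 \<le> surv l k \<and> surv l k \<le> 1"
  by (induction k) auto

lemma surv_mono: "0 \<le> l \<Longrightarrow> l \<le> l' \<Longrightarrow> surv l k \<le> surv l' k"
  by (induction k) (use surv_bounds in \<open>auto intro!: mult_mono\<close>)

lemma surv_le_power: "0 \<le> l \<Longrightarrow> surv l k \<le> l ^ k"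
proof (induction k)
  case (Suc k)
  have "1 - exp (- (l * surv l k)) \<le> l * surv l k"
    using exp_ge_add_one_self[of "- (l * surv l k)"] by linarith
  also have "\<dots> \<le> l * l ^ k" using Suc by (intro mult_left_mono) auto
  finally show ?case by simp
qed simp

text \<open>The square of \<open>1 - x/2 \<le> exp (- x/2)\<close>. The quadratic term is what beats
  the growth rate slightly above 1 in the survival recursion.\<close>

lemma one_minus_exp_le:
  fixes x :: real
  assumes "0 \<le> x" "x \<le> 2"
  shows "1 - exp (- x) \<le> x - x\<^sup>2 / 4"
proof -
  have "(1 - x / 2)\<^sup>2 \<le> (exp (- x / 2))\<^sup>2"
    using assms exp_ge_add_one_self[of "- x / 2"] by (intro power_mono) auto
  also have "\<dots> = exp (- x)" by (simp add: power2_eq_square exp_add[symmetric])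
  finally show ?thesis by (simp add: power2_eq_square field_simps)
qed

text \<open>As long as the survival probability \<open>y\<close> is at least
  \<open>\<epsilon>\<close>, the quadratic term removes \<open>\<epsilon> y / 4\<close> per
  generation while the rate adds at most \<open>\<epsilon> y / 8\<close>, so \<open>y\<close>
  shrinks by the factor \<open>1 - \<epsilon>/8\<close>. Once below \<open>\<epsilon>\<close> it
  stays there, as the recursion is monotone in \<open>y\<close>.\<close>

lemma surv_near_critical:
  assumes "0 < \<epsilon>" "\<epsilon> \<le> 1" "0 \<le> l" "l \<le> 1 + \<epsilon> / 8"
  shows "surv l k \<le> max \<epsilon> ((1 - \<epsilon> / 8) ^ k)"
proof -
  define L where "L = 1 + \<epsilon> / 8"
  have step: "1 - exp (- (L * y)) \<le> y * (1 - \<epsilon> / 8)" if y: "\<epsilon> \<le> y" "y \<le> 1" for y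
  proof -
    have L: "1 \<le> L" "L \<le> 2" using assms by (auto simp: L_def)
    have "L * y \<le> 2 * 1" using L y assms by (intro mult_mono) auto
    hence "1 - exp (- (L * y)) \<le> L * y - (L * y)\<^sup>2 / 4"
      using L y assms by (intro one_minus_exp_le) auto
    also have "(L * y)\<^sup>2 = L\<^sup>2 * (y * y)" by (simp add: power2_eq_square)
    also have "L * y - L\<^sup>2 * (y * y) / 4 \<le> L * y - 1 * (\<epsilon> * y) / 4"
      using L y assms by (intro diff_left_mono divide_right_mono mult_mono) auto
    also have "\<dots> = y * (1 - \<epsilon> / 8)" by (simp add: L_def algebra_simps)
    finally show ?thesis .
  qed
  have "surv L k \<le> max \<epsilon> ((1 - \<epsilon> / 8) ^ k)"
  proof (induction k)
    case (Suc k)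
    have b: "0 \<le> surv L k" "surv L k \<le> 1" using surv_bounds[of L k] assms by (auto simp: L_def)
    show ?case
    proof (cases "surv L k \<le> \<epsilon>")
      case True
      have "1 - exp (- (L * surv L k)) \<le> 1 - exp (- (L * \<epsilon>))"
        using True assms by (auto simp: L_def intro!: mult_left_mono)
      also have "\<dots> \<le> \<epsilon> * (1 - \<epsilon> / 8)" using assms by (intro step) auto
      also have "\<dots> \<le> \<epsilon>" using assms by (simp add: mult_left_le)
      finally show ?thesis by simp
    next
      case False
      hence "surv L (Suc k) \<le> surv L k * (1 - \<epsilon> / 8)" using step b by simp
      also have "\<dots> \<le> (1 - \<epsilon> / 8) ^ k * (1 - \<epsilon> / 8)"
        using False Suc assms by (intro mult_right_mono) auto
      finally show ?thesis by (simp add: mult.commute)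
    qed
  qed simp
  thus ?thesis using surv_mono[OF assms(3,4), of k] by (simp add: L_def)
qed

text \<open>Given the edges avoiding \<open>u\<close>, the path fails to exist with probability
  \<open>(1 - p)^t\<close>, where \<open>t\<close> counts the vertices from which it could continue.
  With the rate \<open>- ln (1 - p)\<close> in place of \<open>p\<close> this is exactly an
  exponential, so the recursion of \<open>surv\<close> appears without an error term.\<close>

lemma rnd_path_from_le:
  assumes "finite V" "card V \<le> n" "0 \<le> p" "p < 1"
  shows "rnd (all_edges V) p (\<lambda>E. of_bool (path_from k V E u)) \<le> surv (real n * (- ln (1 - p))) k"
  using assms(1,2)
proof (induction k arbitrary: V u)
  case 0
  have "rnd (all_edges V) p (\<lambda>E. of_bool (path_from 0 V E u)) \<le> rnd (all_edges V) p (\<lambda>_. 1)"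
    using assms by (intro rnd_mono) auto
  thus ?case using 0 by (simp add: rnd_const)
next
  case (Suc k)
  define L where "L = - ln (1 - p)"
  have L0: "0 \<le> L" using assms by (simp add: L_def)
  have s0: "0 \<le> surv (real n * L) k" using surv_bounds L0 by auto
  show ?case
  proof (cases "u \<in> V")
    case False
    hence "rnd (all_edges V) p (\<lambda>E. of_bool (path_from (Suc k) V E u)) = 0"
      by (simp add: rnd_def)
    moreover have "0 \<le> surv (real n * L) (Suc k)" using surv_bounds L0 by (meson mult_nonneg_nonneg of_nat_0_le_iff)
    ultimately show ?thesis unfolding L_def by linarith
  next
    case u: True
    let ?V = "V - {u}"
    have fV: "finite ?V" "card ?V \<le> n" using Suc.prems u by (auto simp: card_Diff_singleton)
    define T where "T E = {v\<in>?V. path_from k ?V E v}" for E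
    have inner: "rnd (star V u) p (\<lambda>F. of_bool (path_from (Suc k) V (E \<union> F) u))
        = 1 - exp (- L * real (card (T E)))" if E: "E \<subseteq> all_edges ?V" for E
    proof -
      have "of_bool (path_from (Suc k) V (E \<union> F) u)
          = 1 + (- 1) * (of_bool (F \<inter> (\<lambda>v. {u, v}) ` T E = {}) :: real)" if F: "F \<subseteq> star V u" for F
      proof -
        have "path_from k ?V (E \<union> F) v = path_from k ?V E v" for v
          using F by (intro path_from_cong) (auto simp: star_def)
        moreover have "{u, v} \<notin> E" for v using E by (auto simp: all_edges_def)
        ultimately show ?thesis using u by (auto simp: T_def)
      qed
      hence "rnd (star V u) p (\<lambda>F. of_bool (path_from (Suc k) V (E \<union> F) u))
          = rnd (star V u) p (\<lambda>F. 1 + (- 1) * of_bool (F \<inter> (\<lambda>v. {u, v}) ` T E = {}))"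
        by (intro rnd_cong) auto
      also have "\<dots> = 1 - (1 - p) ^ card ((\<lambda>v. {u, v}) ` T E)"
        unfolding rnd_add rnd_cmult using fV
        by (subst rnd_of_bool_disjoint) (auto simp: star_def T_def rnd_const)
      also have "card ((\<lambda>v. {u, v}) ` T E) = card (T E)"
        by (intro card_image) (auto simp: inj_on_def doubleton_eq_iff T_def)
      also have "(1 - p) ^ card (T E) = exp (- L * real (card (T E)))"
        using assms by (simp add: L_def exp_of_nat2_mult mult.commute[of "ln _"] exp_of_nat_mult)
      finally show ?thesis .
    qed
    have "rnd (all_edges ?V) p (\<lambda>E. real (card (T E)))
        = (\<Sum>v\<in>?V. rnd (all_edges ?V) p (\<lambda>E. of_bool (path_from k ?V E v)))"
      unfolding rnd_sum[symmetric]
      unfolding T_def sum_of_bool_card[OF fV(1)] ..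
    also have "\<dots> \<le> (\<Sum>v\<in>?V. surv (real n * L) k)"
      by (intro sum_mono) (use Suc.IH fV in \<open>auto simp: L_def\<close>)
    also have "\<dots> \<le> real n * surv (real n * L) k"
      using fV s0 by (simp add: mult_right_mono)
    finally have mean: "rnd (all_edges ?V) p (\<lambda>E. real (card (T E))) \<le> real n * surv (real n * L) k" .
    have "rnd (all_edges V) p (\<lambda>E. of_bool (path_from (Suc k) V E u))
        = rnd (all_edges ?V) p (\<lambda>E. 1 + (- 1) * exp (- L * real (card (T E))))"
      using inner by (subst rnd_all_edges_star[OF Suc.prems(1) u]) (intro rnd_cong, simp)
    also have "\<dots> = 1 - rnd (all_edges ?V) p (\<lambda>E. exp (- L * real (card (T E))))"
      unfolding rnd_add rnd_cmult using fV by (simp add: rnd_const)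
    \<comment> \<open>Jensen replaces the random number of continuations by its mean; the dependence
      between different continuations is thereby irrelevant.\<close>
    also have "\<dots> \<le> 1 - exp (rnd (all_edges ?V) p (\<lambda>E. - L * real (card (T E))))"
      using jensen_exp_rnd[of "all_edges ?V" p "\<lambda>E. - L * real (card (T E))"] fV assms by simp
    also have "\<dots> \<le> 1 - exp (- (L * (real n * surv (real n * L) k)))"
      unfolding rnd_cmult using mult_left_mono[OF mean L0] by simp
    finally show ?thesis by (simp add: L_def mult.assoc mult.left_commute)
  qed
qed

text \<open>A first moment count: endpoints reached through different neighbours \<open>v\<close>
  are simply added up, and each neighbour is present with probability \<open>p\<close>.\<close>

lemma rnd_path_to_le:
  assumes "finite V" "card V \<le> n" "0 \<le> p" "p \<le> 1"
  shows "rnd (all_edges V) p (\<lambda>E. real (card {w\<in>V. path_to k V E u w})) \<le> (real n * p) ^ k"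
  using assms(1,2)
proof (induction k arbitrary: V u)
  case 0
  have "rnd (all_edges V) p (\<lambda>E. real (card {w\<in>V. path_to 0 V E u w})) \<le> rnd (all_edges V) p (\<lambda>_. 1)"
  proof (rule rnd_mono[OF assms(3,4)])
    fix E
    have "card {w\<in>V. path_to 0 V E u w} \<le> card {u}" by (intro card_mono) auto
    thus "real (card {w\<in>V. path_to 0 V E u w}) \<le> 1" by simp
  qed
  thus ?case using 0 by (simp add: rnd_const)
next
  case (Suc k)
  show ?case
  proof (cases "u \<in> V")
    case False
    thus ?thesis using assms by (simp add: rnd_def)
  next
    case u: True
    let ?V = "V - {u}"
    let ?N = "\<lambda>E v. real (card {w\<in>?V. path_to k ?V E v w})"
    have fV: "finite ?V" "card ?V \<le> n" using Suc.prems u by (auto simp: card_Diff_singleton)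
    have fst: "finite (star V u)" using Suc.prems by (simp add: star_def)
    have bd: "real (card {w\<in>V. path_to (Suc k) V (E \<union> F) u w})
        \<le> (\<Sum>v\<in>?V. ?N E v * of_bool ({u, v} \<in> F))"
      if E: "E \<subseteq> all_edges ?V" and F: "F \<subseteq> star V u" for E F
    proof -
      have 1: "path_to k ?V (E \<union> F) v = path_to k ?V E v" for v
        using F by (intro ext path_to_cong) (auto simp: star_def)
      have 2: "{u, v} \<notin> E" for v using E by (auto simp: all_edges_def)
      have "{w\<in>V. path_to (Suc k) V (E \<union> F) u w}
          \<subseteq> (\<Union>v\<in>?V. if {u, v} \<in> F then {w\<in>?V. path_to k ?V E v w} else {})"
        using 1 2 path_to_subset[of k ?V E] by auto
      hence "card {w\<in>V. path_to (Suc k) V (E \<union> F) u w}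
          \<le> card (\<Union>v\<in>?V. if {u, v} \<in> F then {w\<in>?V. path_to k ?V E v w} else {})"
        using fV by (intro card_mono) auto
      also have "\<dots> \<le> (\<Sum>v\<in>?V. card (if {u, v} \<in> F then {w\<in>?V. path_to k ?V E v w} else {}))"
        using fV by (intro card_UN_le) auto
      finally have "real (card {w\<in>V. path_to (Suc k) V (E \<union> F) u w})
          \<le> (\<Sum>v\<in>?V. real (card (if {u, v} \<in> F then {w\<in>?V. path_to k ?V E v w} else {})))"
        by (simp only: of_nat_sum[symmetric] of_nat_le_iff)
      also have "\<dots> = (\<Sum>v\<in>?V. ?N E v * of_bool ({u, v} \<in> F))" by (intro sum.cong) auto
      finally show ?thesis .
    qed
    have "rnd (all_edges V) p (\<lambda>E. real (card {w\<in>V. path_to (Suc k) V E u w}))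
        = rnd (all_edges ?V) p (\<lambda>E. rnd (star V u) p
            (\<lambda>F. real (card {w\<in>V. path_to (Suc k) V (E \<union> F) u w})))"
      by (rule rnd_all_edges_star[OF Suc.prems(1) u])
    also have "\<dots> \<le> rnd (all_edges ?V) p (\<lambda>E. rnd (star V u) p
        (\<lambda>F. \<Sum>v\<in>?V. ?N E v * of_bool ({u, v} \<in> F)))"
      by (intro rnd_mono bd assms)
    also have "\<dots> = rnd (all_edges ?V) p (\<lambda>E. \<Sum>v\<in>?V. p * ?N E v)"
      unfolding rnd_sum
      by (intro sum.cong refl rnd_cong, unfold rnd_cmult)
         (use fst in \<open>simp add: rnd_of_bool_mem star_def\<close>)
    also have "\<dots> = (\<Sum>v\<in>?V. p * rnd (all_edges ?V) p (\<lambda>E. ?N E v))"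
      unfolding rnd_sum rnd_cmult ..
    also have "\<dots> \<le> (\<Sum>v\<in>?V. p * (real n * p) ^ k)"
      by (intro sum_mono mult_left_mono Suc.IH fV assms)
    also have "\<dots> \<le> real n * (p * (real n * p) ^ k)"
      using fV assms by (simp add: mult_right_mono)
    finally show ?thesis by (simp add: mult.assoc)
  qed
qed

section \<open>Connected pairs and non-isolated vertices\<close>

definition adj :: "'a set set \<Rightarrow> ('a \<times> 'a) set" where
  "adj E = {(a, b). {a, b} \<in> E}"

lemma sym_adj: "sym (adj E)"
  by (auto simp: sym_def adj_def insert_commute)

lemma adj_mono: "E \<subseteq> F \<Longrightarrow> adj E \<subseteq> adj F"
  by (auto simp: adj_def)

text \<open>Cut the walk at its last visit to \<open>u\<close>; the rest avoids \<open>u\<close>.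
  Iterating this, with vertices deleted one by one, turns reachability into a self-avoiding
  path.\<close>

lemma rtrancl_leave:
  assumes "(u, w) \<in> R\<^sup>*"
  shows "u = w \<or> (\<exists>v. (u, v) \<in> R \<and> (v, w) \<in> (R - {(a, b). a = u \<or> b = u})\<^sup>*)"
  using assms
proof (induction rule: rtrancl_induct)
  case (step y z)
  show ?case
  proof (cases "z = u \<or> u = y")
    case True
    thus ?thesis using step.hyps by auto
  next
    case False
    thus ?thesis using step by (blast intro: rtrancl_into_rtrancl)
  qed
qed simp

lemma connected_imp_path_to:
  assumes "finite V" "u \<in> V" "\<And>e. e \<in> E \<Longrightarrow> card e = 2" "(u, w) \<in> (adj (E \<inter> Pow V))\<^sup>*"
  shows "\<exists>k. path_to k V E u w"
  using assms(1,2,4)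
proof (induction "card V" arbitrary: V u)
  case (Suc c)
  show ?case
  proof (cases "u = w")
    case True
    hence "path_to 0 V E u w" using Suc.prems by simp
    thus ?thesis ..
  next
    case False
    then obtain v where v: "(u, v) \<in> adj (E \<inter> Pow V)"
      "(v, w) \<in> (adj (E \<inter> Pow V) - {(a, b). a = u \<or> b = u})\<^sup>*"
      using rtrancl_leave[OF Suc.prems(3)] by blast
    have "adj (E \<inter> Pow V) - {(a, b). a = u \<or> b = u} \<subseteq> adj (E \<inter> Pow (V - {u}))"
      by (auto simp: adj_def)
    hence 1: "(v, w) \<in> (adj (E \<inter> Pow (V - {u})))\<^sup>*" using v(2) rtrancl_mono by blast
    have e: "{u, v} \<in> E" "v \<in> V" using v by (auto simp: adj_def)
    have "v \<noteq> u" using assms(3)[OF e(1)] by auto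
    hence v': "v \<in> V - {u}" using e by simp
    have "c = card (V - {u})" using Suc by (simp add: card_Diff_singleton)
    then obtain k where "path_to k (V - {u}) E v w"
      using Suc.hyps(1)[of "V - {u}" v] Suc.prems v' 1 by auto
    hence "path_to (Suc k) V E u w" using v' e Suc.prems by auto
    thus ?thesis ..
  qed
qed auto

definition conn_pairs :: "'a set \<Rightarrow> 'a set set \<Rightarrow> ('a \<times> 'a) set" where
  "conn_pairs V E = {(u, w). u \<in> V \<and> w \<in> V \<and> u \<noteq> w \<and> (u, w) \<in> (adj E)\<^sup>*}"

lemma finite_conn_pairs [simp]: "finite V \<Longrightarrow> finite (conn_pairs V E)"
  by (rule finite_subset[of _ "V \<times> V"]) (auto simp: conn_pairs_def)

lemma conn_pairs_incr:
  assumes "finite V"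
  shows "incr_on S (\<lambda>E. real (card (conn_pairs V E)))"
  unfolding incr_on_def
proof (intro allI impI)
  fix E F :: "'a set set" assume "E \<subseteq> F"
  hence "(adj E)\<^sup>* \<subseteq> (adj F)\<^sup>*" by (intro rtrancl_mono adj_mono)
  hence "conn_pairs V E \<subseteq> conn_pairs V F" by (auto simp: conn_pairs_def)
  thus "real (card (conn_pairs V E)) \<le> real (card (conn_pairs V F))"
    using assms by (simp add: card_mono)
qed

definition touched :: "'a set \<Rightarrow> 'a set set \<Rightarrow> 'a set" where
  "touched V E = {u\<in>V. \<exists>e\<in>E. u \<in> e}"

lemma touched_incr:
  assumes "finite V"
  shows "incr_on S (\<lambda>E. real (card (touched V E)))"
  unfolding incr_on_def
proof (intro allI impI)
  fix E F :: "'a set set" assume "E \<subseteq> F"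
  hence "touched V E \<subseteq> touched V F" by (auto simp: touched_def)
  thus "real (card (touched V E)) \<le> real (card (touched V F))"
    using assms by (simp add: card_mono touched_def)
qed

text \<open>A connected pair is joined either by a path shorter than \<open>r\<close>, counted by
  its endpoints, or by a longer one; then \<open>u\<close> starts a path of length \<open>r\<close>
  and all of \<open>V\<close> is conceded as possible partners.\<close>

lemma conn_pairs_le:
  assumes "finite V" "E \<subseteq> all_edges V"
  shows "real (card (conn_pairs V E))
    \<le> (\<Sum>u\<in>V. (\<Sum>k<r. real (card {w\<in>V. path_to k V E u w})) + real (card V) * of_bool (path_from r V E u))"
proof -
  let ?D = "\<lambda>u. (\<Union>k<r. {w\<in>V. path_to k V E u w}) \<union> (if path_from r V E u then V else {})"
  have "conn_pairs V E \<subseteq> (SIGMA u:V. ?D u)"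
  proof (rule subrelI)
    fix u w assume "(u, w) \<in> conn_pairs V E"
    hence uw: "u \<in> V" "w \<in> V" "u \<noteq> w" "(u, w) \<in> (adj E)\<^sup>*" by (auto simp: conn_pairs_def)
    have "E \<inter> Pow V = E" using assms by (auto simp: all_edges_def)
    then obtain k where k: "path_to k V E u w"
      using connected_imp_path_to[of V u E w] assms uw by (auto simp: all_edges_def)
    show "(u, w) \<in> (SIGMA u:V. ?D u)"
    proof (cases "k < r")
      case False
      thus ?thesis using path_to_imp_path_from[OF k, of r] uw by simp
    qed (use k uw in auto)
  qed
  hence "card (conn_pairs V E) \<le> card (SIGMA u:V. ?D u)"
    using assms by (intro card_mono) auto
  also have "\<dots> = (\<Sum>u\<in>V. card (?D u))" using assms by (intro card_SigmaI) auto
  also have "real \<dots> \<le> (\<Sum>u\<in>V. (\<Sum>k<r. real (card {w\<in>V. path_to k V E u w}))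
      + real (card V) * of_bool (path_from r V E u))"
    unfolding of_nat_sum
  proof (rule sum_mono)
    fix u
    have "card (?D u) \<le> card (\<Union>k<r. {w\<in>V. path_to k V E u w}) + card (if path_from r V E u then V else {})"
      by (rule card_Un_le)
    also have "\<dots> \<le> (\<Sum>k<r. card {w\<in>V. path_to k V E u w}) + card (if path_from r V E u then V else {})"
      by (intro add_mono card_UN_le) auto
    finally have "real (card (?D u)) \<le> real ((\<Sum>k<r. card {w\<in>V. path_to k V E u w})
        + card (if path_from r V E u then V else {}))" by (simp only: of_nat_le_iff)
    thus "real (card (?D u)) \<le> (\<Sum>k<r. real (card {w\<in>V. path_to k V E u w}))
      + real (card V) * of_bool (path_from r V E u)" by auto
  qed
  finally show ?thesis by simp
qed

text \<open>For fixed \<open>r\<close> and bounded mean degree the first summand is linear in the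
  number of vertices. The quadratic one carries the survival probability, so choosing
  \<open>r\<close> before letting the number of vertices grow makes the proportion of connected
  pairs small.\<close>

lemma rnd_conn_pairs_le:
  assumes "finite V" "0 \<le> p" "p < 1"
  shows "rnd (all_edges V) p (\<lambda>E. real (card (conn_pairs V E)))
    \<le> real (card V) * (\<Sum>k<r. (real (card V) * p) ^ k)
      + (real (card V))\<^sup>2 * surv (real (card V) * (- ln (1 - p))) r"
proof -
  let ?n = "real (card V)"
  have "rnd (all_edges V) p (\<lambda>E. real (card (conn_pairs V E)))
    \<le> rnd (all_edges V) p (\<lambda>E. \<Sum>u\<in>V. (\<Sum>k<r. real (card {w\<in>V. path_to k V E u w}))
        + ?n * of_bool (path_from r V E u))"
    using assms by (intro rnd_mono conn_pairs_le) auto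
  also have "\<dots> = (\<Sum>u\<in>V. (\<Sum>k<r. rnd (all_edges V) p (\<lambda>E. real (card {w\<in>V. path_to k V E u w})))
        + ?n * rnd (all_edges V) p (\<lambda>E. of_bool (path_from r V E u)))"
    by (simp only: rnd_sum rnd_add rnd_cmult)
  also have "\<dots> \<le> (\<Sum>u\<in>V. (\<Sum>k<r. (?n * p) ^ k) + ?n * surv (?n * (- ln (1 - p))) r)"
    using assms by (intro sum_mono add_mono mult_left_mono rnd_path_to_le rnd_path_from_le) auto
  finally show ?thesis by (simp add: power2_eq_square algebra_simps)
qed

lemma rnd_touched_le:
  assumes "finite V" "0 \<le> p" "p < 1"
  shows "rnd (all_edges V) p (\<lambda>E. real (card (touched V E)))
    \<le> real (card V) * surv (real (card V) * (- ln (1 - p))) 1"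
proof -
  let ?n = "real (card V)"
  have t: "real (card (touched V E)) \<le> (\<Sum>u\<in>V. of_bool (path_from 1 V E u))" if E: "E \<subseteq> all_edges V" for E
  proof -
    have "touched V E \<subseteq> {u\<in>V. path_from 1 V E u}"
    proof
      fix u assume "u \<in> touched V E"
      then obtain e where e: "u \<in> V" "e \<in> E" "u \<in> e" by (auto simp: touched_def)
      then obtain v where "e = {u, v}" "v \<noteq> u"
        using E unfolding all_edges_def card_2_iff by (smt (verit, best) doubleton_eq_iff insert_iff mem_Collect_eq singletonD subsetD)
      moreover have "v \<in> V" using e E calculation by (auto simp: all_edges_def)
      ultimately show "u \<in> {u\<in>V. path_from 1 V E u}" using e by auto
    qed
    hence "card (touched V E) \<le> card {u\<in>V. path_from 1 V E u}"
      using assms by (intro card_mono) auto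
    thus ?thesis unfolding sum_of_bool_card[OF assms(1)] by (simp only: of_nat_le_iff)
  qed
  have "rnd (all_edges V) p (\<lambda>E. real (card (touched V E)))
      \<le> (\<Sum>u\<in>V. rnd (all_edges V) p (\<lambda>E. of_bool (path_from 1 V E u)))"
    unfolding rnd_sum[symmetric] using assms by (intro rnd_mono t) auto
  also have "\<dots> \<le> (\<Sum>u\<in>V. surv (?n * (- ln (1 - p))) 1)"
    using assms by (intro sum_mono rnd_path_from_le) auto
  finally show ?thesis by simp
qed

section \<open>Bisections\<close>

definition crosses :: "'a set \<Rightarrow> 'a set \<Rightarrow> bool" where
  "crosses A e \<longleftrightarrow> e \<inter> A \<noteq> {} \<and> \<not> e \<subseteq> A"

definition cut_edges :: "'a set set \<Rightarrow> 'a set \<Rightarrow> 'a set set" where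
  "cut_edges E A = {e\<in>E. crosses A e}"

definition halves :: "'a set \<Rightarrow> 'a set set" where
  "halves V = {A. A \<subseteq> V \<and> card A = card V div 2}"

definition max_bisection :: "'a set \<Rightarrow> 'a set set \<Rightarrow> nat" where
  "max_bisection V E = Max ((\<lambda>A. card (cut_edges E A)) ` halves V)"

text \<open>The distance to bipartiteness: the least number of edges whose removal leaves a
  bipartite graph. No balance is required here.\<close>

definition min_uncut :: "'a set \<Rightarrow> 'a set set \<Rightarrow> nat" where
  "min_uncut V E = Min ((\<lambda>A. card (E - cut_edges E A)) ` Pow V)"

lemma all_edgesE:
  assumes "e \<in> all_edges V"
  obtains a b where "e = {a, b}" "a \<noteq> b" "a \<in> V" "b \<in> V"
  using assms unfolding all_edges_def card_2_iff by blast

lemma doubleton_in_cut_iff: "{a, b} \<in> cut_edges E A \<longleftrightarrow> {a, b} \<in> E \<and> (a \<in> A) \<noteq> (b \<in> A)"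
  by (auto simp: cut_edges_def crosses_def)

lemma cut_insert: "cut_edges (insert e E) A = (if crosses A e then insert e (cut_edges E A) else cut_edges E A)"
  by (auto simp: cut_edges_def)

lemma finite_cut [simp]: "finite E \<Longrightarrow> finite (cut_edges E A)"
  by (simp add: cut_edges_def crosses_def)

lemma finite_edges: "finite V \<Longrightarrow> E \<subseteq> all_edges V \<Longrightarrow> finite E"
  by (rule finite_subset[OF _ finite_all_edges])

lemma halves_nonempty:
  assumes "finite V"
  shows "halves V \<noteq> {}"
  using obtain_subset_with_card_n[of "card V div 2" V] by (auto simp: halves_def)

lemma finite_halves: "finite V \<Longrightarrow> finite (halves V)"
  unfolding halves_def by (rule finite_subset[of _ "Pow V"]) auto

lemma max_bisection_ge: "finite V \<Longrightarrow> A \<in> halves V \<Longrightarrow> card (cut_edges E A) \<le> max_bisection V E"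
  unfolding max_bisection_def by (intro Max_ge) (auto simp: finite_halves)

lemma max_bisection_attained:
  assumes "finite V"
  obtains A where "A \<in> halves V" "max_bisection V E = card (cut_edges E A)"
proof -
  have "max_bisection V E \<in> (\<lambda>A. card (cut_edges E A)) ` halves V"
    unfolding max_bisection_def using assms
    by (intro Max_in) (auto simp: finite_halves halves_nonempty)
  thus ?thesis using that by auto
qed

lemma min_uncut_le: "finite V \<Longrightarrow> A \<subseteq> V \<Longrightarrow> min_uncut V E \<le> card (E - cut_edges E A)"
  unfolding min_uncut_def by (intro Min_le) auto

lemma min_uncut_attained:
  assumes "finite V"
  obtains A where "A \<subseteq> V" "min_uncut V E = card (E - cut_edges E A)"
proof -
  have "min_uncut V E \<in> (\<lambda>A. card (E - cut_edges E A)) ` Pow V"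
    unfolding min_uncut_def using assms by (intro Min_in) auto
  thus ?thesis using that by auto
qed

lemma card_cut_insert_le:
  assumes "finite E"
  shows "card (cut_edges (insert e E) A) \<le> card (cut_edges E A) + 1" "card (cut_edges E A) \<le> card (cut_edges (insert e E) A)"
  using assms by (auto simp: cut_insert card_insert_if intro: card_mono)

lemma max_bisection_swap_lipschitz:
  assumes "finite V"
  shows "swap_lipschitz (all_edges V) 1 (\<lambda>E. real (max_bisection V E))"
proof -
  have le: "max_bisection V (insert a E) \<le> max_bisection V (insert b E) + 1"
    if E: "E \<subseteq> all_edges V" for a b E
  proof -
    obtain A where A: "A \<in> halves V" "max_bisection V (insert a E) = card (cut_edges (insert a E) A)"
      using max_bisection_attained[OF assms] .
    have fE: "finite E" using E assms by (rule finite_edges[rotated])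
    have "card (cut_edges (insert a E) A) \<le> card (cut_edges (insert b E) A) + 1"
      using card_cut_insert_le(1)[OF fE, of a A] card_cut_insert_le(2)[OF fE, of A b] by simp
    thus ?thesis using A max_bisection_ge[OF assms A(1), of "insert b E"] by simp
  qed
  show ?thesis unfolding swap_lipschitz_def
  proof (intro allI impI)
    fix E a b assume "E \<subseteq> all_edges V"
    from le[OF this, of a b] le[OF this, of b a]
    show "\<bar>real (max_bisection V (insert a E)) - real (max_bisection V (insert b E))\<bar> \<le> 1"
      by linarith
  qed
qed

section \<open>Growth of the maximum bisection\<close>

lemma card_cut_all_edges:
  assumes "finite V" "A \<subseteq> V"
  shows "card (cut_edges (all_edges V) A) = card A * card (V - A)"
proof -
  have "cut_edges (all_edges V) A = (\<lambda>(a, b). {a, b}) ` (A \<times> (V - A))"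
  proof (intro set_eqI iffI)
    fix e assume e: "e \<in> cut_edges (all_edges V) A"
    then obtain a b where ab: "e = {a, b}" "a \<noteq> b" "a \<in> V" "b \<in> V"
      unfolding cut_edges_def crosses_def by (blast elim: all_edgesE)
    hence "(a \<in> A) \<noteq> (b \<in> A)" using e by (simp add: doubleton_in_cut_iff)
    thus "e \<in> (\<lambda>(a, b). {a, b}) ` (A \<times> (V - A))"
      using ab by (cases "a \<in> A") (force simp: insert_commute)+
  next
    fix e assume "e \<in> (\<lambda>(a, b). {a, b}) ` (A \<times> (V - A))"
    thus "e \<in> cut_edges (all_edges V) A"
      using assms by (auto simp: cut_edges_def crosses_def all_edges_def card_2_iff)
  qed
  moreover have "inj_on (\<lambda>(a, b). {a, b}) (A \<times> (V - A))"
    by (auto simp: inj_on_def doubleton_eq_iff)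
  ultimately show ?thesis by (simp add: card_image card_cartesian_product)
qed

text \<open>For \<open>n = 2k\<close> this compares \<open>k^2\<close> with
  \<open>k(2k-1)/2\<close>, for \<open>n = 2k+1\<close> it compares \<open>k(k+1)\<close> with
  \<open>k(2k+1)/2\<close>. It is the source of the gain \<open>1/2\<close> per random edge.\<close>

lemma halves_product_ge:
  assumes "finite V" "A \<in> halves V"
  shows "real (card V choose 2) / 2 \<le> real (card A * card (V - A))"
proof -
  define n where "n = card V"
  have A: "card A = n div 2" "card (V - A) = n - n div 2"
    using assms by (auto simp: halves_def n_def card_Diff_subset finite_subset)
  have c: "real (n choose 2) = real n * (real n - 1) / 2"
    by (cases n) (auto simp: choose_two real_of_nat_div algebra_simps)
  show ?thesis
  proof (cases "even n")
    case True
    then obtain k where "n = 2 * k" by blast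
    thus ?thesis using c A by (simp add: n_def[symmetric] field_simps)
  next
    case False
    then obtain k where "n = 2 * k + 1" by (elim oddE)
    thus ?thesis using c A by (simp add: n_def[symmetric] field_simps)
  qed
qed

text \<open>Keep an optimal bisection of the present graph: it separates at least half of all pairs,
  so a uniformly chosen new edge crosses it with probability close to \<open>1/2\<close>.\<close>

lemma avg_max_bisection_Suc:
  assumes V: "finite V" and m: "m < card V choose 2"
  shows "avg (all_edges V) (Suc m) (\<lambda>E. real (max_bisection V E))
    \<ge> avg (all_edges V) m (\<lambda>E. real (max_bisection V E)) + 1 / 2
        - real m / (2 * (real (card V choose 2) - real m))"
proof -
  let ?S = "all_edges V" and ?N = "card V choose 2"
  let ?f = "\<lambda>E. real (max_bisection V E)"
  let ?c = "1 / 2 - real m / (2 * (real ?N - real m))"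
  have S: "finite ?S" "card ?S = ?N" using V by (auto simp: card_all_edges)
  have pos: "real ?N - real m > 0" using m by simp
  have ceq: "?c * (real ?N - real m) = real ?N / 2 - real m" using pos by (simp add: field_simps)
  have "avg ?S m (\<lambda>E. ?f E + ?c) \<le> avg ?S m (\<lambda>E. (\<Sum>e\<in>?S - E. ?f (insert e E)) / real (card ?S - m))"
  proof (rule avg_mono)
    fix E assume "E \<in> slice ?S m"
    hence E: "E \<subseteq> ?S" "card E = m" by (auto simp: slice_def)
    have fE: "finite E" using E V by (intro finite_edges)
    obtain A where A: "A \<in> halves V" "max_bisection V E = card (cut_edges E A)"
      using max_bisection_attained[OF V] .
    have cS: "card (?S - E) = ?N - m" using E fE S by (simp add: card_Diff_subset)
    \<comment> \<open>A pessimistic count: all \<open>m\<close> present edges are taken to be among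
      the separated pairs. This produces the error \<open>m / (2 (N - m))\<close>.\<close>
    have "real ?N / 2 - real m \<le> real (card (cut_edges ?S A)) - real (card E)"
      using halves_product_ge[OF V A(1)] card_cut_all_edges[of V A] V A E
      by (auto simp: halves_def)
    also have "\<dots> \<le> real (card (cut_edges (?S - E) A))"
    proof -
      have "cut_edges ?S A \<subseteq> cut_edges (?S - E) A \<union> E" by (auto simp: cut_edges_def crosses_def)
      hence "card (cut_edges ?S A) \<le> card (cut_edges (?S - E) A \<union> E)"
        using S fE by (intro card_mono) auto
      also have "\<dots> \<le> card (cut_edges (?S - E) A) + card E" by (rule card_Un_le)
      finally show ?thesis by simp
    qed
    also have "real (card (cut_edges (?S - E) A)) = (\<Sum>e\<in>?S - E. of_bool (crosses A e))"
      using S by (subst sum_of_bool_card) (auto simp: cut_edges_def)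
    finally have cr: "real ?N / 2 - real m \<le> (\<Sum>e\<in>?S - E. of_bool (crosses A e))" .
    have "(\<Sum>e\<in>?S - E. ?f E + of_bool (crosses A e)) \<le> (\<Sum>e\<in>?S - E. ?f (insert e E))"
    proof (rule sum_mono)
      fix e assume e: "e \<in> ?S - E"
      have "card (cut_edges (insert e E) A) = card (cut_edges E A) + of_bool (crosses A e)"
        using e fE by (simp add: cut_insert card_insert_if) (simp add: cut_edges_def)
      thus "?f E + of_bool (crosses A e) \<le> ?f (insert e E)"
        using max_bisection_ge[OF V A(1), of "insert e E"] A by (cases "crosses A e") auto
    qed
    hence "(real ?N - real m) * ?f E + (real ?N / 2 - real m) \<le> (\<Sum>e\<in>?S - E. ?f (insert e E))"
      using cr cS m by (simp add: sum.distrib of_nat_diff)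
    hence "(?f E + ?c) * (real ?N - real m) \<le> (\<Sum>e\<in>?S - E. ?f (insert e E))"
      unfolding distrib_right ceq by (simp only: mult.commute)
    thus "?f E + ?c \<le> (\<Sum>e\<in>?S - E. ?f (insert e E)) / real (card ?S - m)"
      using pos S m by (simp add: pos_le_divide_eq of_nat_diff)
  qed
  also have "avg ?S m (\<lambda>E. ?f E + ?c) = avg ?S m ?f + ?c"
    using S m by (simp only: avg_add) (subst avg_const, auto)
  finally have "avg ?S m ?f + ?c \<le> avg ?S (Suc m) ?f"
    using S m by (subst avg_Suc) auto
  thus ?thesis by linarith
qed

text \<open>Summation of the single steps; since \<open>2 m < N\<close>, the error of each is at
  most \<open>m / N\<close>.\<close>

lemma avg_max_bisection_mono:
  assumes V: "finite V" and m: "m0 \<le> m" "2 * m < card V choose 2"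
  shows "avg (all_edges V) m (\<lambda>E. real (max_bisection V E))
    \<ge> avg (all_edges V) m0 (\<lambda>E. real (max_bisection V E))
      + real (m - m0) * (1 / 2 - real m / real (card V choose 2))"
proof -
  let ?N = "real (card V choose 2)"
  define h where "h k = avg (all_edges V) k (\<lambda>E. real (max_bisection V E))" for k
  define c where "c = 1 / 2 - real m / ?N"
  have "h m0 + real (k - m0) * c \<le> h k" if "m0 \<le> k" "k \<le> m" for k
    using that
  proof (induction k rule: dec_induct)
    case (step k)
    have N: "?N > 0" "2 * real k < ?N" "k < card V choose 2" using step.prems m by linarith+
    have "real k / (2 * (?N - real k)) \<le> real m / ?N"
      using step.prems N by (intro frac_le) auto
    hence "h k + c \<le> h (Suc k)"
      using avg_max_bisection_Suc[OF V N(3)] unfolding h_def c_def by linarith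
    moreover have "real (Suc k - m0) * c = real (k - m0) * c + c"
      using step.hyps by (simp add: Suc_diff_le distrib_right)
    ultimately show ?case using step.IH step.prems by simp
  qed simp
  thus ?thesis using m unfolding h_def c_def by simp
qed

section \<open>Edges left uncut by the best cut\<close>

definition flip :: "'a set \<Rightarrow> 'a set \<Rightarrow> 'a set" where
  "flip A C = (A - C) \<union> (C - A)"

lemma mem_flip_iff: "x \<in> flip A C \<longleftrightarrow> (x \<in> A) \<noteq> (x \<in> C)"
  by (auto simp: flip_def)

lemma cut_flip:
  assumes "E \<subseteq> all_edges V" "\<And>a b. {a, b} \<in> E \<Longrightarrow> a \<in> C \<longleftrightarrow> b \<in> C"
  shows "cut_edges E (flip A C) = cut_edges E A"
proof (intro set_eqI)
  fix e
  show "e \<in> cut_edges E (flip A C) \<longleftrightarrow> e \<in> cut_edges E A"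
  proof (cases "e \<in> E")
    case True
    then obtain a b where "e = {a, b}" using assms by (blast elim: all_edgesE)
    thus ?thesis using assms(2)[of a b] True by (auto simp: doubleton_in_cut_iff mem_flip_iff)
  qed (simp add: cut_edges_def crosses_def)
qed

definition component :: "'a set \<Rightarrow> 'a set set \<Rightarrow> 'a \<Rightarrow> 'a set" where
  "component V E u = {w\<in>V. (u, w) \<in> (adj E)\<^sup>*}"

lemma component_closed:
  assumes "E \<subseteq> all_edges V" "{a, b} \<in> E"
  shows "a \<in> component V E u \<longleftrightarrow> b \<in> component V E u"
proof -
  have "(a, b) \<in> adj E" "(b, a) \<in> adj E" using assms by (auto simp: adj_def insert_commute)
  moreover have "a \<in> V" "b \<in> V" using assms by (auto simp: all_edges_def)
  ultimately show ?thesis by (auto simp: component_def intro: rtrancl_into_rtrancl)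
qed

text \<open>If the new edge joins two components, flipping one of them if necessary puts the edge
  into the cut and changes no other edge. Only an edge inside a component can increase the minimum,
  and then by at most 1.\<close>

lemma min_uncut_insert:
  assumes V: "finite V" and E: "E \<subseteq> all_edges V" and uv: "u \<in> V" "v \<in> V" "u \<noteq> v"
  shows "min_uncut V (insert {u, v} E) \<le> min_uncut V E + of_bool ((u, v) \<in> (adj E)\<^sup>*)"
proof -
  let ?e = "{u, v}"
  obtain A where A: "A \<subseteq> V" "min_uncut V E = card (E - cut_edges E A)"
    using min_uncut_attained[OF V] .
  have fE: "finite E" using E V by (rule finite_edges[rotated])
  show ?thesis
  proof (cases "(u, v) \<in> (adj E)\<^sup>*")
    case True
    have "card (insert ?e E - cut_edges (insert ?e E) A) \<le> card (insert ?e (E - cut_edges E A))"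
      using fE by (intro card_mono) (auto simp: cut_edges_def crosses_def)
    also have "\<dots> \<le> card (E - cut_edges E A) + 1" by (simp add: card_insert_if fE)
    finally show ?thesis using A min_uncut_le[OF V A(1), of "insert ?e E"] True by simp
  next
    case False
    define B where "B = (if (u \<in> A) \<noteq> (v \<in> A) then A else flip A (component V E u))"
    have cutB: "cut_edges E B = cut_edges E A"
      unfolding B_def using cut_flip[OF E component_closed[OF E]] by simp
    have "u \<in> component V E u" "v \<notin> component V E u" using uv False by (auto simp: component_def)
    hence e: "?e \<in> cut_edges (insert ?e E) B"
      unfolding doubleton_in_cut_iff B_def by (auto simp: mem_flip_iff)
    have "B \<subseteq> V" using A by (auto simp: B_def flip_def component_def)
    hence "min_uncut V (insert ?e E) \<le> card (insert ?e E - cut_edges (insert ?e E) B)"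
      by (rule min_uncut_le[OF V])
    also have "\<dots> \<le> card (E - cut_edges E B)"
      using e fE by (intro card_mono) (auto simp: cut_edges_def crosses_def)
    finally show ?thesis using A cutB by simp
  qed
qed

text \<open>The new edge is uniform among the \<open>N - m\<close> missing ones, and those joining
  connected vertices number at most \<open>card (conn_pairs V E)\<close>.\<close>

lemma avg_min_uncut_Suc:
  assumes V: "finite V" and m: "m < card V choose 2"
  shows "avg (all_edges V) (Suc m) (\<lambda>E. real (min_uncut V E))
    \<le> avg (all_edges V) m (\<lambda>E. real (min_uncut V E))
      + avg (all_edges V) m (\<lambda>E. real (card (conn_pairs V E))) / (real (card V choose 2) - real m)"
proof -
  let ?S = "all_edges V" and ?N = "card V choose 2"
  let ?f = "\<lambda>E. real (min_uncut V E)"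
  let ?c = "1 / (real ?N - real m)"
  have S: "finite ?S" "card ?S = ?N" using V by (auto simp: card_all_edges)
  have pos: "real ?N - real m > 0" using m by simp
  have "avg ?S m (\<lambda>E. (\<Sum>e\<in>?S - E. ?f (insert e E)) / real (card ?S - m))
      \<le> avg ?S m (\<lambda>E. ?f E + ?c * real (card (conn_pairs V E)))"
  proof (rule avg_mono)
    fix E assume "E \<in> slice ?S m"
    hence E: "E \<subseteq> ?S" "card E = m" by (auto simp: slice_def)
    have fE: "finite E" using E V by (intro finite_edges)
    have cS: "card (?S - E) = ?N - m" using E fE S by (simp add: card_Diff_subset)
    define B where "B = (\<lambda>(u, v). {u, v}) ` conn_pairs V E"
    have "?f (insert e E) \<le> ?f E + of_bool (e \<in> B)" if e: "e \<in> ?S - E" for e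
    proof -
      obtain u v where uv: "e = {u, v}" "u \<noteq> v" "u \<in> V" "v \<in> V" using e by (blast elim: all_edgesE)
      have "(u, v) \<in> (adj E)\<^sup>* \<Longrightarrow> e \<in> B"
        using uv by (auto simp: B_def conn_pairs_def intro!: image_eqI[of _ _ "(u, v)"])
      hence "of_bool ((u, v) \<in> (adj E)\<^sup>*) \<le> (of_bool (e \<in> B) :: nat)" by auto
      hence "min_uncut V (insert e E) \<le> min_uncut V E + of_bool (e \<in> B)"
        using min_uncut_insert[OF V E(1) uv(3,4,2)] uv(1) by (cases "(u, v) \<in> (adj E)\<^sup>*") auto
      hence "real (min_uncut V (insert e E)) \<le> real (min_uncut V E + of_bool (e \<in> B))"
        by (simp only: of_nat_le_iff)
      thus ?thesis by simp
    qed
    hence "(\<Sum>e\<in>?S - E. ?f (insert e E)) \<le> (\<Sum>e\<in>?S - E. ?f E + of_bool (e \<in> B))"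
      by (rule sum_mono)
    also have "\<dots> = (real ?N - real m) * ?f E + real (card {e\<in>?S - E. e \<in> B})"
      using S cS m by (simp add: sum.distrib sum_of_bool_card of_nat_diff del: sum_of_bool_eq)
    also have "card {e\<in>?S - E. e \<in> B} \<le> card B"
      unfolding B_def using V by (intro card_mono) auto
    also have "card B \<le> card (conn_pairs V E)"
      unfolding B_def using V by (intro card_image_le) simp
    finally have "(\<Sum>e\<in>?S - E. ?f (insert e E)) \<le> (real ?N - real m) * ?f E + real (card (conn_pairs V E))"
      by simp
    moreover have "(\<Sum>e\<in>?S - E. ?f (insert e E)) / real (card ?S - m) \<le> ?f E + ?c * real (card (conn_pairs V E))"
      if le: "(\<Sum>e\<in>?S - E. ?f (insert e E)) \<le> (real ?N - real m) * ?f E + real (card (conn_pairs V E))"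
    proof -
      have "(real ?N - real m) * ?f E + real (card (conn_pairs V E))
          = (?f E + ?c * real (card (conn_pairs V E))) * (real ?N - real m)"
        using pos by (simp add: distrib_right)
      thus ?thesis using le pos S m by (simp add: pos_divide_le_eq of_nat_diff)
    qed
    ultimately show "(\<Sum>e\<in>?S - E. ?f (insert e E)) / real (card ?S - m) \<le> ?f E + ?c * real (card (conn_pairs V E))"
      by blast
  qed
  hence "avg ?S (Suc m) ?f \<le> avg ?S m (\<lambda>E. ?f E + ?c * real (card (conn_pairs V E)))"
    using S m by (subst avg_Suc) auto
  thus ?thesis unfolding avg_add avg_cmult by simp
qed

text \<open>All ordered pairs within a component are connected. Hence few connected pairs exclude
  large components, with no separate analysis of component sizes.\<close>

lemma component_card_le:
  assumes "finite V" "u \<in> V"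
  shows "card (component V E u) * (card (component V E u) - 1) \<le> card (conn_pairs V E)"
proof -
  let ?C = "component V E u"
  have fin: "finite ?C" using assms by (simp add: component_def)
  have "?C \<times> ?C - Id \<subseteq> conn_pairs V E"
  proof
    fix x assume "x \<in> ?C \<times> ?C - Id"
    then obtain a b where x: "x = (a, b)" "a \<noteq> b" "a \<in> V" "b \<in> V" "(u, a) \<in> (adj E)\<^sup>*" "(u, b) \<in> (adj E)\<^sup>*"
      by (auto simp: component_def)
    have "(a, u) \<in> (adj E)\<^sup>*" by (rule symD[OF sym_rtrancl[OF sym_adj] x(5)])
    hence "(a, b) \<in> (adj E)\<^sup>*" using x(6) by (rule rtrancl_trans)
    thus "x \<in> conn_pairs V E" using x by (simp add: conn_pairs_def)
  qed
  hence "card (?C \<times> ?C - Id) \<le> card (conn_pairs V E)" using assms by (intro card_mono) auto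
  moreover have "?C \<times> ?C - Id = ?C \<times> ?C - (\<lambda>x. (x, x)) ` ?C" by auto
  moreover have "card (?C \<times> ?C - (\<lambda>x. (x, x)) ` ?C) = card ?C * card ?C - card ?C"
    using fin by (subst card_Diff_subset) (auto simp: card_cartesian_product card_image inj_on_def)
  ultimately show ?thesis by (simp add: diff_mult_distrib2)
qed

text \<open>Among the cuts leaving the fewest edges uncut take one minimising the imbalance on the
  non-isolated vertices: flipping a component on the heavy side shows that this imbalance is at most
  the size of that component. The isolated vertices then complete the cut to a bisection.\<close>

lemma max_bisection_ge_uncut:
  assumes V: "finite V" and E: "E \<subseteq> all_edges V"
    and L: "card (conn_pairs V E) < L * (L - 1)" "L + card (touched V E) \<le> card V"
  shows "card E \<le> max_bisection V E + min_uncut V E"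
proof -
  let ?T = "touched V E"
  define imb where "imb A = int (card (A \<inter> ?T)) - int (card (?T - A))" for A
  have fT: "finite ?T" and TV: "?T \<subseteq> V" using V by (auto simp: touched_def)
  obtain A0 where A0: "A0 \<subseteq> V" "min_uncut V E = card (E - cut_edges E A0)"
    using min_uncut_attained[OF V] .
  define opt where "opt A \<longleftrightarrow> A \<subseteq> V \<and> min_uncut V E = card (E - cut_edges E A)" for A
  have "opt A0" using A0 by (simp add: opt_def)
  from ex_has_least_nat[of opt, OF this, of "\<lambda>A. nat \<bar>imb A\<bar>"]
  obtain A where A: "opt A" and least: "\<forall>B. opt B \<longrightarrow> nat \<bar>imb A\<bar> \<le> nat \<bar>imb B\<bar>" by blast
  have Amin: "\<bar>imb A\<bar> \<le> \<bar>imb B\<bar>" if "opt B" for B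
    using least[rule_format, OF that] by linarith
  define s where "s x = (if x \<in> A then 1 else - 1 :: int)" for x
  have imb_sum: "imb A = (\<Sum>x\<in>?T. s x)"
  proof -
    have "(\<Sum>x\<in>?T. s x) = (\<Sum>x\<in>?T \<inter> A. 1) + (\<Sum>x\<in>?T - A. - 1)"
      using sum.Int_Diff[OF fT, of s A] by (simp add: s_def)
    thus ?thesis by (simp add: imb_def Int_commute)
  qed
  have small: "\<bar>imb A\<bar> < int L"
  proof (cases "imb A = 0")
    case True
    thus ?thesis using L by (cases L) auto
  next
    case False
    define R where "R = {(a, b). a \<in> V \<and> b \<in> V \<and> (a, b) \<in> (adj E)\<^sup>*}"
    have R: "equiv V R"
    proof (rule equivI)
      show "R \<subseteq> V \<times> V" by (auto simp: R_def)
      show "refl_on V R" by (auto simp: refl_on_def R_def)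
      show "sym R"
      proof (rule symI)
        fix a b assume "(a, b) \<in> R"
        thus "(b, a) \<in> R" using symD[OF sym_rtrancl[OF sym_adj], of a b E] by (simp add: R_def)
      qed
      show "trans R"
      proof (rule transI)
        fix a b c assume "(a, b) \<in> R" "(b, c) \<in> R"
        thus "(a, c) \<in> R" by (auto simp: R_def intro: rtrancl_trans)
      qed
    qed
    have cls: "\<exists>u\<in>V. K = component V E u" if "K \<in> V // R" for K
      using that by (auto simp: quotient_def R_def component_def)
    have "imb A = (\<Sum>x\<in>V. if x \<in> ?T then s x else 0)"
      using V TV unfolding imb_sum by (subst sum.inter_restrict[symmetric]) (auto simp: Int_absorb1)
    also have "\<dots> = (\<Sum>K\<in>V // R. \<Sum>x\<in>K. if x \<in> ?T then s x else 0)"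
    proof -
      have "(\<Sum>x\<in>\<Union>(V // R). if x \<in> ?T then s x else 0) = (\<Sum>K\<in>V // R. \<Sum>x\<in>K. if x \<in> ?T then s x else 0)"
      proof -
        have d1: "\<forall>K\<in>V // R. finite K"
        proof
          fix K assume "K \<in> V // R"
          then obtain u where "K = component V E u" using cls by blast
          thus "finite K" using V by (simp add: component_def)
        qed
        have d2: "\<forall>K\<in>V // R. \<forall>K'\<in>V // R. K \<noteq> K' \<longrightarrow> K \<inter> K' = {}"
          using quotient_disj[OF R] by blast
        show ?thesis by (simp add: sum.Union_disjoint[OF d1 d2])
      qed
      thus ?thesis using Union_quotient[OF R] by simp
    qed
    finally have tot: "imb A = (\<Sum>K\<in>V // R. \<Sum>x\<in>K. if x \<in> ?T then s x else 0)" .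
    \<comment> \<open>Some component leans to the same side as the whole: otherwise all products
      would be at most 0, and their sum is \<open>imb A * imb A\<close>.\<close>
    have "\<exists>K\<in>V // R. (\<Sum>x\<in>K. if x \<in> ?T then s x else 0) * imb A > 0"
    proof (rule ccontr)
      assume "\<not> ?thesis"
      hence "(\<Sum>K\<in>V // R. (\<Sum>x\<in>K. if x \<in> ?T then s x else 0) * imb A) \<le> 0"
        by (intro sum_nonpos) (auto simp: not_less)
      hence "imb A * imb A \<le> 0" using tot by (simp only: sum_distrib_right[symmetric])
      thus False using False by (auto simp: mult_le_0_iff)
    qed
    then obtain u where u: "u \<in> V" and
      b: "(\<Sum>x\<in>component V E u. if x \<in> ?T then s x else 0) * imb A > 0"
      using cls by blast
    let ?C = "component V E u"
    let ?b = "\<Sum>x\<in>?C. if x \<in> ?T then s x else 0"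
    have fC: "finite ?C" using V by (simp add: component_def)
    have "opt (flip A ?C)"
      using A cut_flip[OF E component_closed[OF E]] by (auto simp: opt_def flip_def component_def)
    hence le: "\<bar>imb A\<bar> \<le> \<bar>imb (flip A ?C)\<bar>" by (rule Amin)
    have "imb (flip A ?C) = (\<Sum>x\<in>?T. if x \<in> flip A ?C then 1 else - 1)"
    proof -
      have "(\<Sum>x\<in>?T. if x \<in> flip A ?C then 1 else - 1)
        = (\<Sum>x\<in>?T \<inter> flip A ?C. 1) + (\<Sum>x\<in>?T - flip A ?C. - 1 :: int)"
        using sum.Int_Diff[OF fT, of "\<lambda>x. if x \<in> flip A ?C then 1 else - 1 :: int" "flip A ?C"] by simp
      thus ?thesis by (simp add: imb_def Int_commute)
    qed
    also have "\<dots> = (\<Sum>x\<in>?T. s x - 2 * (if x \<in> ?C then s x else 0))"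
      by (intro sum.cong) (auto simp: s_def mem_flip_iff)
    also have "\<dots> = imb A - 2 * (\<Sum>x\<in>?T. if x \<in> ?C then s x else 0)"
      by (simp add: imb_sum sum_subtractf sum_distrib_left)
    also have "(\<Sum>x\<in>?T. if x \<in> ?C then s x else 0) = ?b"
      using fT fC by (simp add: Int_commute flip: sum.inter_restrict)
    finally have fl: "imb (flip A ?C) = imb A - 2 * ?b" .
    \<comment> \<open>\<open>imb A\<close> and \<open>?b\<close> have the same sign, so subtracting
      \<open>2 * ?b\<close> fails to reduce the absolute value only if it overshoots, that is, if
      \<open>?b\<close> is at least as large as \<open>imb A\<close> in absolute value.\<close>
    have "\<bar>imb A\<bar> \<le> \<bar>?b\<bar>"
      using le b unfolding fl zero_less_mult_iff by linarith
    also have "\<dots> \<le> (\<Sum>x\<in>?C. 1)"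
      by (rule order_trans[OF sum_abs]) (intro sum_mono, auto simp: s_def)
    finally have bC: "\<bar>imb A\<bar> \<le> int (card ?C)" by simp
    show ?thesis
    proof (rule ccontr)
      assume "\<not> ?thesis"
      hence "L \<le> card ?C" using bC by linarith
      hence "L * (L - 1) \<le> card ?C * (card ?C - 1)" by (intro mult_mono) auto
      thus False using component_card_le[OF V u, of E] L by linarith
    qed
  qed
  define n where "n = card V"
  define a where "a = card (A \<inter> ?T)"
  define b where "b = card (?T - A)"
  have ab: "a + b = card ?T"
    using fT card_Int_Diff[of ?T A] by (simp add: a_def b_def Int_commute)
  have "\<bar>int a - int b\<bar> < int L" using small by (simp add: imb_def a_def b_def)
  \<comment> \<open>\<open>2 * a\<close> is the sum of \<open>a + b\<close>, at most
    \<open>n - L\<close>, and \<open>a - b\<close>, less than \<open>L\<close>. So each side of the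
    cut fits into half of the vertices, and isolated vertices fill it up.\<close>
  hence "2 * a < n" "2 * b < n" using L(2) ab by (auto simp: n_def)
  hence j: "a \<le> n div 2" "n div 2 - a \<le> n - card ?T" using ab by linarith+
  have "card (V - ?T) = n - card ?T" using TV fT by (simp add: n_def card_Diff_subset)
  then obtain J where J: "J \<subseteq> V - ?T" "card J = n div 2 - a" "finite J"
    using obtain_subset_with_card_n[of "n div 2 - a" "V - ?T"] j by metis
  let ?B = "(A \<inter> ?T) \<union> J"
  have "card ?B = n div 2"
    using J fT j by (subst card_Un_disjoint) (auto simp: a_def)
  hence B: "?B \<in> halves V" using J TV by (auto simp: halves_def n_def)
  have "cut_edges E ?B = cut_edges E A"
  proof -
    have "e \<subseteq> ?T" if "e \<in> E" for e
      using E that by (auto simp: touched_def all_edges_def)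
    hence "crosses ?B e = crosses A e" if "e \<in> E" for e
      using J that unfolding crosses_def by blast
    thus ?thesis unfolding cut_edges_def by blast
  qed
  hence "card (cut_edges E A) \<le> max_bisection V E" using max_bisection_ge[OF V B, of E] by simp
  moreover have "card (cut_edges E A) + card (E - cut_edges E A) = card E"
  proof -
    have "finite E" using E V by (rule finite_edges[rotated])
    thus ?thesis using card_Int_Diff[of E "cut_edges E A"] by (simp add: cut_edges_def crosses_def Int_def)
  qed
  ultimately show ?thesis using A by (simp add: opt_def)
qed

section \<open>Modularity of dense graphs\<close>

lemma card_incident_all_edges:
  assumes "finite V" "v \<in> V"
  shows "card {e \<in> all_edges V. v \<in> e} = card V - 1"
proof -
  have "{e \<in> all_edges V. v \<in> e} = star V v"
  proof (intro set_eqI iffI)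
    fix e assume "e \<in> {e \<in> all_edges V. v \<in> e}"
    then obtain a b where "e = {a, b}" "a \<noteq> b" "a \<in> V" "b \<in> V" "v \<in> {a, b}"
      by (blast elim: all_edgesE)
    thus "e \<in> star V v" by (auto simp: star_def insert_commute)
  next
    fix e assume "e \<in> star V v"
    thus "e \<in> {e \<in> all_edges V. v \<in> e}"
      using all_edges_star(1)[OF assms(2)] by (auto simp: star_def)
  qed
  moreover have "card (star V v) = card (V - {v})"
    unfolding star_def by (intro card_image) (auto simp: inj_on_def doubleton_eq_iff)
  ultimately show ?thesis using assms by (simp add: card_Diff_singleton)
qed

lemma vertices_nonempty: "E \<subseteq> all_edges V \<Longrightarrow> 0 < card E \<Longrightarrow> V \<noteq> {}"
  by (cases "E = {}") (auto simp: all_edges_def)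

lemma deg_complement:
  assumes "finite V" "E \<subseteq> all_edges V" "v \<in> V"
  shows "deg E v + deg (all_edges V - E) v = card V - 1"
proof -
  have "finite E" using assms by (intro finite_edges)
  hence "card ({e \<in> E. v \<in> e} \<union> {e \<in> all_edges V - E. v \<in> e}) = deg E v + deg (all_edges V - E) v"
    unfolding deg_def using assms by (intro card_Un_disjoint) auto
  moreover have "{e \<in> E. v \<in> e} \<union> {e \<in> all_edges V - E. v \<in> e} = {e \<in> all_edges V. v \<in> e}"
    using assms by auto
  ultimately show ?thesis using card_incident_all_edges[OF assms(1,3)] by simp
qed

lemma vol_complement:
  assumes "finite V" "E \<subseteq> all_edges V" "A \<subseteq> V"
  shows "vol E A + vol (all_edges V - E) A = card A * (card V - 1)"
proof -
  have "vol E A + vol (all_edges V - E) A = (\<Sum>v\<in>A. deg E v + deg (all_edges V - E) v)"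
    by (simp add: vol_def sum.distrib)
  also have "\<dots> = (\<Sum>v\<in>A. card V - 1)"
    using assms deg_complement[OF assms(1,2)] by (intro sum.cong) auto
  finally show ?thesis by simp
qed

lemma handshake:
  assumes "finite V" "E \<subseteq> all_edges V"
  shows "vol E V = 2 * card E"
proof -
  have fE: "finite E" using assms by (intro finite_edges)
  have "vol E V = (\<Sum>v\<in>V. \<Sum>e\<in>E. if v \<in> e then 1 else 0)"
    unfolding vol_def deg_def using fE by (simp add: sum.If_cases Int_def)
  also have "\<dots> = (\<Sum>e\<in>E. \<Sum>v\<in>V. if v \<in> e then 1 else 0)" by (rule sum.swap)
  also have "\<dots> = (\<Sum>e\<in>E. 2)"
  proof (rule sum.cong)
    fix e assume "e \<in> E"
    hence e: "e \<subseteq> V" "card e = 2" using assms by (auto simp: all_edges_def)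
    have "(\<Sum>v\<in>V. if v \<in> e then 1 else 0) = card (V \<inter> e)"
      using assms by (simp add: sum.If_cases Int_def)
    thus "(\<Sum>v\<in>V. if v \<in> e then 1 else 0) = (2 :: nat)" using e by (simp add: Int_absorb1)
  qed simp
  finally show ?thesis by simp
qed

lemma edges_within_le:
  assumes "finite V" "E \<subseteq> all_edges V" "A \<subseteq> V"
  shows "2 * real (edges_within E A) \<le> (real (card A))\<^sup>2"
proof -
  have fA: "finite A" using assms finite_subset by blast
  have "edges_within E A \<le> card (all_edges A)"
    unfolding edges_within_def using assms fA by (intro card_mono) (auto simp: all_edges_def)
  also have "\<dots> = card A choose 2" by (rule card_all_edges[OF fA])
  finally have "2 * edges_within E A \<le> card A * (card A - 1)" by (simp add: choose_two)
  also have "\<dots> \<le> card A * card A" by simp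
  finally have "real (2 * edges_within E A) \<le> real (card A * card A)" by (simp only: of_nat_le_iff)
  thus ?thesis by (simp add: power2_eq_square)
qed

lemma sum_vol_partition:
  assumes "finite V" "partition_on V \<A>"
  shows "(\<Sum>A\<in>\<A>. vol E A) = vol E V"
proof -
  have d1: "\<forall>A\<in>\<A>. finite A"
    using assms(1) partition_onD1[OF assms(2)] by (auto intro: finite_subset)
  have d2: "\<forall>A\<in>\<A>. \<forall>B\<in>\<A>. A \<noteq> B \<longrightarrow> A \<inter> B = {}"
    using partition_onD2[OF assms(2)] by (auto simp: disjoint_def)
  have "V = \<Union>\<A>" by (rule partition_onD1[OF assms(2)])
  thus ?thesis unfolding vol_def by (simp add: sum.Union_disjoint[OF d1 d2])
qed

text \<open>A part with \<open>x\<close> vertices has at most \<open>x^2 / 2\<close> inner edges and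
  volume \<open>x (n - 1) - w\<close>. By \<open>dense\<close> the terms quadratic in
  \<open>x\<close> cancel in the right direction; what survives is the cross term in
  \<open>w\<close>, and the values \<open>w\<close> sum to twice the number of missing
  edges.\<close>

lemma modularity_le:
  assumes V: "finite V" and E: "E \<subseteq> all_edges V" "0 < card E" and P: "partition_on V \<A>"
    and dense: "2 * real (card E) \<le> (real (card V) - 1)\<^sup>2"
  shows "modularity_of E \<A> \<le> (real (card V))\<^sup>2 * real (card (all_edges V - E)) / (real (card E))\<^sup>2"
proof -
  define n m where "n = real (card V)" and "m = real (card E)"
  let ?H = "all_edges V - E"
  have m: "m > 0" using E by (simp add: m_def)
  have "V \<noteq> {}" using E by (rule vertices_nonempty)
  hence n: "n \<ge> 1" using V by (simp add: n_def Suc_leI card_gt_0_iff)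
  have sub: "A \<subseteq> V" if "A \<in> \<A>" for A using that partition_onD1[OF P] by blast
  have term_le: "real (edges_within E A) / m - (real (vol E A))\<^sup>2 / (4 * m\<^sup>2)
      \<le> 2 * n\<^sup>2 * real (vol ?H A) / (4 * m\<^sup>2)" if "A \<in> \<A>" for A
  proof -
    define x w where "x = real (card A)" and "w = real (vol ?H A)"
    have x: "0 \<le> x" "x \<le> n" using card_mono[OF V sub[OF that]] by (auto simp: x_def n_def)
    have w: "0 \<le> w" by (simp add: w_def)
    have "real (vol E A + vol ?H A) = real (card A * (card V - 1))"
      using vol_complement[OF V E(1) sub[OF that]] by simp
    hence vol: "real (vol E A) = x * (n - 1) - w"
      using n by (simp add: x_def w_def n_def of_nat_diff)
    have "4 * m * real (edges_within E A) \<le> 2 * m * x\<^sup>2"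
      using mult_left_mono[OF edges_within_le[OF V E(1) sub[OF that]], of "2 * m"] m
      by (simp add: x_def)
    also have "\<dots> \<le> (n - 1)\<^sup>2 * x\<^sup>2" using dense by (intro mult_right_mono) (auto simp: n_def m_def)
    finally have 1: "4 * m * real (edges_within E A) \<le> (n - 1)\<^sup>2 * x\<^sup>2" .
    have "x * (n - 1) * w \<le> n\<^sup>2 * w"
      unfolding power2_eq_square using x n w by (intro mult_right_mono mult_mono) auto
    moreover have "(x * (n - 1) - w)\<^sup>2 = (n - 1)\<^sup>2 * x\<^sup>2 - 2 * (x * (n - 1) * w) + w\<^sup>2"
      by (simp add: power2_eq_square algebra_simps)
    ultimately have "4 * m * real (edges_within E A) - (real (vol E A))\<^sup>2 \<le> 2 * n\<^sup>2 * w"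
      using 1 zero_le_power2[of w] unfolding vol by linarith
    hence "(4 * m * real (edges_within E A) - (real (vol E A))\<^sup>2) / (4 * m\<^sup>2) \<le> 2 * n\<^sup>2 * w / (4 * m\<^sup>2)"
      by (intro divide_right_mono) auto
    moreover have "(4 * m * real (edges_within E A) - (real (vol E A))\<^sup>2) / (4 * m\<^sup>2)
        = real (edges_within E A) / m - (real (vol E A))\<^sup>2 / (4 * m\<^sup>2)"
      using m by (simp add: diff_divide_distrib power2_eq_square)
    ultimately show ?thesis by (simp add: w_def)
  qed
  have "modularity_of E \<A> = (\<Sum>A\<in>\<A>. real (edges_within E A) / m - (real (vol E A))\<^sup>2 / (4 * m\<^sup>2))"
    by (simp add: modularity_of_def m_def sum_subtractf sum_divide_distrib)
  also have "\<dots> \<le> (\<Sum>A\<in>\<A>. 2 * n\<^sup>2 * real (vol ?H A) / (4 * m\<^sup>2))"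
    by (intro sum_mono term_le)
  also have "\<dots> = 2 * n\<^sup>2 / (4 * m\<^sup>2) * (\<Sum>A\<in>\<A>. real (vol ?H A))"
    by (simp add: sum_distrib_left)
  also have "(\<Sum>A\<in>\<A>. real (vol ?H A)) = real (2 * card ?H)"
    using sum_vol_partition[OF V P, of ?H] handshake[OF V, of ?H] by (simp flip: of_nat_sum)
  also have "2 * n\<^sup>2 / (4 * m\<^sup>2) * real (2 * card ?H) = n\<^sup>2 * real (card ?H) / m\<^sup>2"
    by simp
  finally show ?thesis by (simp add: n_def m_def)
qed

lemma finite_modularities:
  assumes "finite V"
  shows "finite {modularity_of E \<A> | \<A>. partition_on V \<A>}"
proof -
  have "{modularity_of E \<A> | \<A>. partition_on V \<A>} \<subseteq> modularity_of E ` Pow (Pow V)"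
    by (auto dest: partition_onD1)
  thus ?thesis by (rule finite_subset) (use assms in simp)
qed

lemma max_modularity_le:
  assumes "finite V" "E \<subseteq> all_edges V" "0 < card E" "2 * real (card E) \<le> (real (card V) - 1)\<^sup>2"
  shows "max_modularity V E \<le> (real (card V))\<^sup>2 * real (card (all_edges V - E)) / (real (card E))\<^sup>2"
proof -
  have "V \<noteq> {}" using assms(2,3) by (rule vertices_nonempty)
  hence "partition_on V {V}" by (rule partition_on_space)
  thus ?thesis unfolding max_modularity_def
    using finite_modularities[OF assms(1), of E] modularity_le[OF assms(1,2,3) _ assms(4)]
    by (intro Max.boundedI) auto
qed

text \<open>The modularity of the two halves, rewritten through the complement. The volumes sum to
  \<open>2 m\<close>, so only their difference enters beyond the constant \<open>1/2\<close>. That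
  difference is at most \<open>n + 2 M\<close>; in sparse complements its square over
  \<open>8 m^2\<close> has order \<open>1/n^2\<close>, below the scale \<open>1/n\<close> of the
  main term.\<close>

lemma max_modularity_ge:
  assumes V: "finite V" "2 \<le> card V" and E: "E \<subseteq> all_edges V" "0 < card E"
  shows "(real (max_bisection V (all_edges V - E)) - real (card (all_edges V - E)) / 2 - real (card V) / 4)
      / real (card E) - (real (card V) + 2 * real (card (all_edges V - E)))\<^sup>2 / (8 * (real (card E))\<^sup>2)
    \<le> max_modularity V E"
proof -
  let ?H = "all_edges V - E"
  define n m M where "n = real (card V)" and "m = real (card E)" and "M = real (card ?H)"
  have m: "m > 0" using E by (simp add: m_def)
  have fE: "finite E" using E V by (intro finite_edges)
  obtain A where A: "A \<in> halves V" "max_bisection V ?H = card (cut_edges ?H A)"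
    using max_bisection_attained[OF V(1)] .
  define B where "B = V - A"
  have AV: "A \<subseteq> V" "card A = card V div 2" using A by (auto simp: halves_def)
  have fA: "finite A" using AV V finite_subset by blast
  have cB: "card B = card V - card V div 2"
    using AV fA by (simp add: B_def card_Diff_subset)
  have ne: "A \<noteq> {}" "B \<noteq> {}" using AV cB V by auto
  have AB: "A \<noteq> B" "A \<inter> B = {}" "A \<union> B = V" using ne AV by (auto simp: B_def)
  have P: "partition_on V {A, B}"
    using ne AB by (auto simp: partition_on_def disjoint_def)
  define a b where "a = real (card A)" and "b = real (card B)"
  have ab: "a + b = n" "\<bar>a - b\<bar> \<le> 1"
    using AV cB by (auto simp: a_def b_def n_def)
  define vA vB where "vA = real (vol E A)" and "vB = real (vol E B)"
  have "vol E A + vol E B = vol E V"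
    unfolding vol_def using AB fA V by (subst sum.union_disjoint[symmetric]) (auto simp: B_def)
  hence vAB: "vA + vB = 2 * m"
    using handshake[OF V(1) E(1)] by (simp add: vA_def vB_def m_def flip: of_nat_add)
  have edges: "edges_within E A + edges_within E B + card (cut_edges E A) = card E"
  proof -
    have sub: "e \<subseteq> A \<union> B \<and> e \<noteq> {}" if "e \<in> E" for e
      using E(1) that AB(3) unfolding all_edges_def by auto
    hence d: "{e \<in> E. e \<subseteq> A} \<inter> {e \<in> E. e \<subseteq> B} = {}"
      using AB(2) by blast
    have "{e \<in> E. e \<subseteq> A} \<union> {e \<in> E. e \<subseteq> B} \<union> cut_edges E A = E"
      using sub unfolding cut_edges_def crosses_def by blast
    moreover have "({e \<in> E. e \<subseteq> A} \<union> {e \<in> E. e \<subseteq> B}) \<inter> cut_edges E A = {}"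
      using sub AB(2) unfolding cut_edges_def crosses_def by blast
    ultimately show ?thesis unfolding edges_within_def
      using fE d card_Un_disjoint[of "{e \<in> E. e \<subseteq> A}" "{e \<in> E. e \<subseteq> B}"]
        card_Un_disjoint[of "{e \<in> E. e \<subseteq> A} \<union> {e \<in> E. e \<subseteq> B}" "cut_edges E A"] by simp
  qed
  have cuts: "card (cut_edges E A) + card (cut_edges ?H A) = card A * card B"
  proof -
    have "cut_edges E A \<union> cut_edges ?H A = cut_edges (all_edges V) A"
      using E(1) unfolding cut_edges_def by blast
    moreover have "card (cut_edges E A \<union> cut_edges ?H A) = card (cut_edges E A) + card (cut_edges ?H A)"
    proof (rule card_Un_disjoint)
      show "finite (cut_edges E A)" "finite (cut_edges ?H A)" using fE V by simp_all
      show "cut_edges E A \<inter> cut_edges ?H A = {}" unfolding cut_edges_def by blast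
    qed
    ultimately show ?thesis using card_cut_all_edges[OF V(1) AV(1)] by (simp add: B_def)
  qed
  define h where "h = real (card (cut_edges ?H A))"
  define e where "e = real (edges_within E A) + real (edges_within E B)"
  have e: "e = m - a * b + h"
  proof -
    have "e + real (card (cut_edges E A)) = m"
      using arg_cong[OF edges, of real] by (simp add: e_def m_def)
    moreover have "real (card (cut_edges E A)) + h = a * b"
      using arg_cong[OF cuts, of real] by (simp add: h_def a_def b_def)
    ultimately show ?thesis by linarith
  qed
  have mM: "m + M = n * (n - 1) / 2"
  proof -
    have "card E + card ?H = card V choose 2"
      using card_all_edges[OF V(1)] E fE card_mono[OF finite_all_edges[OF V(1)] E(1)]
      by (simp add: card_Diff_subset)
    hence "m + M = real (card V choose 2)" by (simp add: m_def M_def flip: of_nat_add)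
    also have "\<dots> = n * (n - 1) / 2"
      unfolding n_def by (cases "card V") (auto simp: choose_two real_of_nat_div algebra_simps)
    finally show ?thesis .
  qed
  have "4 * (a * b) = n\<^sup>2 - (a - b)\<^sup>2" unfolding ab(1)[symmetric] by (simp add: power2_eq_square algebra_simps)
  hence abn: "4 * (a * b) \<le> n\<^sup>2" by simp
  have D: "\<bar>vA - vB\<bar> \<le> n + 2 * M"
  proof -
    have n1: "real (card V - 1) = n - 1" using V by (simp add: n_def of_nat_diff)
    have "real (vol E A + vol ?H A) = a * (n - 1)" "real (vol E B + vol ?H B) = b * (n - 1)"
      using vol_complement[OF V(1) E(1), of A] vol_complement[OF V(1) E(1), of B] AV n1
      by (auto simp: a_def b_def B_def)
    hence "vA - vB = (a - b) * (n - 1) - real (vol ?H A) + real (vol ?H B)"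
      by (simp add: vA_def vB_def algebra_simps)
    moreover have "\<bar>(a - b) * (n - 1)\<bar> \<le> n"
    proof -
      have "\<bar>a - b\<bar> * \<bar>n - 1\<bar> \<le> 1 * (n - 1)"
        using ab V by (intro mult_mono) (auto simp: n_def)
      thus ?thesis by (simp add: abs_mult)
    qed
    moreover have "real (vol ?H A) + real (vol ?H B) = 2 * M"
    proof -
      have "vol ?H A + vol ?H B = vol ?H V"
        unfolding vol_def using AB fA V by (subst sum.union_disjoint[symmetric]) (auto simp: B_def)
      thus ?thesis using handshake[OF V(1), of ?H] by (simp add: M_def flip: of_nat_add)
    qed
    ultimately show ?thesis by linarith
  qed
  have "modularity_of E {A, B} = e / m - (vA\<^sup>2 + vB\<^sup>2) / (4 * m\<^sup>2)"
    using AB by (simp add: modularity_of_def e_def m_def vA_def vB_def add_divide_distrib)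
  also have "vA\<^sup>2 + vB\<^sup>2 = ((2 * m)\<^sup>2 + (vA - vB)\<^sup>2) / 2"
    unfolding vAB[symmetric] by (simp add: power2_eq_square algebra_simps)
  also have "e / m - ((2 * m)\<^sup>2 + (vA - vB)\<^sup>2) / 2 / (4 * m\<^sup>2)
      = (e - m / 2) / m - (vA - vB)\<^sup>2 / (8 * m\<^sup>2)"
  proof -
    have "((2 * m)\<^sup>2 + (vA - vB)\<^sup>2) / 2 / (4 * m\<^sup>2) = 1 / 2 + (vA - vB)\<^sup>2 / (8 * m\<^sup>2)"
      using m by (simp add: add_divide_distrib power_mult_distrib)
    moreover have "(e - m / 2) / m = e / m - 1 / 2" using m by (simp add: diff_divide_distrib)
    ultimately show ?thesis by linarith
  qed
  finally have q: "modularity_of E {A, B} = (e - m / 2) / m - (vA - vB)\<^sup>2 / (8 * m\<^sup>2)" .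
  \<comment> \<open>The origin of \<open>n/4\<close>: \<open>m/2 + M/2\<close> equals
    \<open>n(n-1)/4\<close>, whereas \<open>a * b\<close> may be as large as
    \<open>n^2/4\<close>.\<close>
  have "e - m / 2 \<ge> h - M / 2 - n / 4"
    using mM abn unfolding e by (simp add: power2_eq_square algebra_simps)
  hence "(h - M / 2 - n / 4) / m \<le> (e - m / 2) / m" using m by (simp add: divide_right_mono)
  moreover have "(vA - vB)\<^sup>2 / (8 * m\<^sup>2) \<le> (n + 2 * M)\<^sup>2 / (8 * m\<^sup>2)"
    using D by (intro divide_right_mono) (auto simp: abs_le_square_iff[symmetric])
  ultimately have "(h - M / 2 - n / 4) / m - (n + 2 * M)\<^sup>2 / (8 * m\<^sup>2) \<le> modularity_of E {A, B}"
    unfolding q by linarith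
  also have "\<dots> \<le> max_modularity V E"
    unfolding max_modularity_def using P finite_modularities[OF V(1)] by (intro Max_ge) auto
  finally show ?thesis by (simp add: h_def n_def m_def M_def A(2))
qed

section \<open>The random graph slightly above criticality\<close>

lemma eventually_real_ge: "\<forall>\<^sub>F n in sequentially. C \<le> real n"
  using filterlim_real_sequentially unfolding filterlim_at_top by blast

lemma choose_two_real: "real (n choose 2) = real n * (real n - 1) / 2"
  by (cases n) (auto simp: choose_two real_of_nat_div algebra_simps)

text \<open>With edge probability \<open>c'/n\<close> the mean number of edges exceeds
  \<open>j\<close> by at least \<open>(c' - c) n / 4\<close>, while its variance is only of order
  \<open>n\<close>. The factor lost in the comparison thus tends to 1; \<open>11/10\<close> is a
  convenient constant above 1.\<close>

lemma eventually_avg_le_rnd: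
  fixes c c' :: real
  assumes "0 \<le> c" "c < c'"
  shows "\<forall>\<^sub>F n in sequentially. \<forall>j f. real j \<le> c * real n / 2 \<longrightarrow> incr_on (all_edges {1..n}) f \<longrightarrow>
    (\<forall>E. 0 \<le> f E) \<longrightarrow>
    avg (all_edges {1..n}) j f \<le> 11 / 10 * rnd (all_edges {1..n}) (c' / real n) f"
  using eventually_real_ge[of 1] eventually_real_ge[of "2 * c' / (c' - c)"] eventually_real_ge[of c']
    eventually_real_ge[of "88 * c' / (c' - c)\<^sup>2"]
proof eventually_elim
  case (elim n)
  define d where "d = c' - c"
  have d: "d > 0" and c': "c' > 0" using assms by (auto simp: d_def)
  have n: "real n > 0" using elim by simp
  show ?case
  proof (intro allI impI)
    fix j f assume j: "real j \<le> c * real n / 2"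
      and f: "incr_on (all_edges {1..n}) f" "\<forall>E. 0 \<le> f E"
    let ?S = "all_edges {1..n}"
    let ?Np = "real (card ?S) * (c' / real n)"
    have Np: "?Np = c' * (real n - 1) / 2"
      using n by (simp add: card_all_edges choose_two_real field_simps)
    have "2 * c' \<le> d * real n" using elim(2) d by (simp add: d_def[symmetric] field_simps)
    hence gap: "d * real n / 4 \<le> ?Np - real j"
      using j unfolding Np d_def by (simp add: field_simps)
    have dn: "d * real n / 4 > 0" using d n by simp
    have "?Np / (?Np - real j)\<^sup>2 \<le> (c' * real n / 2) / (d * real n / 4)\<^sup>2"
      using gap dn c' n unfolding Np
      by (intro frac_le power_mono) auto
    also have "\<dots> = 8 * c' / (d\<^sup>2 * real n)" using n d by (simp add: power2_eq_square field_simps)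
    also have "\<dots> \<le> 1 / 11"
      using elim(4) d n by (simp add: d_def[symmetric] field_simps)
    finally have r: "10 / 11 \<le> 1 - ?Np / (?Np - real j)\<^sup>2" by simp
    have "avg ?S j f * (10 / 11) \<le> avg ?S j f * (1 - ?Np / (?Np - real j)\<^sup>2)"
      using f by (intro mult_left_mono r avg_nonneg) auto
    also have "\<dots> \<le> rnd ?S (c' / real n) f"
    proof (intro avg_le_rnd)
      show "real j < ?Np" using gap dn by linarith
    qed (use f elim c' n in \<open>auto simp: divide_le_eq\<close>)
    finally show "avg ?S j f \<le> 11 / 10 * rnd ?S (c' / real n) f" by simp
  qed
qed

lemma eventually_log_rate_le:
  fixes c c' :: real
  assumes "0 < c" "c < c'"
  shows "\<forall>\<^sub>F n in sequentially. c / real n < 1 \<and> 0 \<le> real n * (- ln (1 - c / real n)) \<and>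
    real n * (- ln (1 - c / real n)) \<le> c'"
  using eventually_real_ge[of 1] eventually_real_ge[of "c' * c / (c' - c)"] eventually_real_ge[of "2 * c"]
proof eventually_elim
  case (elim n)
  have n: "real n > 0" using elim by simp
  define p where "p = c / real n"
  have p: "0 \<le> p" "p < 1" using elim n assms by (auto simp: p_def divide_less_eq)
  have "ln (1 / (1 - p)) \<le> 1 / (1 - p) - 1" using p by (intro ln_le_minus_one) auto
  hence "- ln (1 - p) \<le> p / (1 - p)" using p by (simp add: ln_div field_simps)
  hence "real n * (- ln (1 - p)) \<le> real n * (p / (1 - p))" by (intro mult_left_mono) auto
  also have "\<dots> = c / (1 - p)" using n by (simp add: p_def)
  also have "\<dots> \<le> c'"
  proof -
    have "c' * c \<le> real n * (c' - c)" using elim(2) assms by (simp add: pos_divide_le_eq)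
    hence "c' * p \<le> c' - c" using n by (simp add: p_def pos_divide_le_eq mult.commute)
    hence "c \<le> c' * (1 - p)" by (simp add: right_diff_distrib)
    thus ?thesis using p by (simp add: pos_divide_le_eq)
  qed
  finally have "real n * (- ln (1 - p)) \<le> c'" .
  moreover have "0 \<le> real n * (- ln (1 - p))" using p by (intro mult_nonneg_nonneg) auto
  ultimately show ?case using p by (simp add: p_def)
qed

text \<open>There are two comparisons to pay for, from a fixed number of edges to independent edges
  and from \<open>p\<close> to \<open>- ln (1 - p)\<close>; the intermediate rate \<open>b\<close>
  leaves room for both. The short paths contribute only linearly in \<open>n\<close> and are
  absorbed by the gap between \<open>surv c' r\<close> and \<open>\<epsilon>\<close>.\<close>

lemma eventually_avg_conn_pairs_le:
  fixes c c' \<epsilon> :: real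
  assumes "0 < c" "c < c'" "surv c' r < \<epsilon>"
  shows "\<forall>\<^sub>F n in sequentially. \<forall>j. real j \<le> c * real n / 2 \<longrightarrow>
    avg (all_edges {1..n}) j (\<lambda>E. real (card (conn_pairs {1..n} E))) \<le> 2 * \<epsilon> * (real n)\<^sup>2"
proof -
  define b where "b = (c + c') / 2"
  have b: "0 < b" "c < b" "b < c'" using assms by (auto simp: b_def)
  define K where "K = (\<Sum>k<r. b ^ k)"
  define g where "g = \<epsilon> - surv c' r"
  have g: "g > 0" using assms by (simp add: g_def)
  have \<epsilon>: "\<epsilon> > 0" using assms surv_bounds[of c' r] by simp
  show ?thesis
    using eventually_avg_le_rnd[OF less_imp_le[OF assms(1)] b(2)] eventually_log_rate_le[OF b(1,3)]
      eventually_real_ge[of 1] eventually_real_ge[of "K / g"]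
  proof eventually_elim
    case (elim n)
    have n: "real n > 0" using elim by simp
    let ?S = "all_edges {1..n}"
    let ?Z = "\<lambda>E. real (card (conn_pairs {1..n} E))"
    have "rnd ?S (b / real n) ?Z
      \<le> real n * (\<Sum>k<r. (real n * (b / real n)) ^ k)
        + (real n)\<^sup>2 * surv (real n * (- ln (1 - b / real n))) r"
      using rnd_conn_pairs_le[of "{1..n}" "b / real n" r] elim b n by simp
    also have "\<dots> \<le> real n * K + (real n)\<^sup>2 * surv c' r"
      using elim b n by (intro add_mono mult_left_mono surv_mono) (auto simp: K_def)
    also have "\<dots> \<le> (real n)\<^sup>2 * g + (real n)\<^sup>2 * surv c' r"
    proof -
      have "K \<le> real n * g" using elim g by (simp add: pos_divide_le_eq)
      hence "real n * K \<le> real n * (real n * g)" using n by (intro mult_left_mono) auto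
      thus ?thesis by (simp add: power2_eq_square)
    qed
    also have "\<dots> = \<epsilon> * (real n)\<^sup>2" by (simp add: g_def algebra_simps)
    finally have rn: "rnd ?S (b / real n) ?Z \<le> \<epsilon> * (real n)\<^sup>2" .
    have "\<epsilon> * (real n)\<^sup>2 \<ge> 0" using \<epsilon> by simp
    hence "11 / 10 * rnd ?S (b / real n) ?Z \<le> 2 * \<epsilon> * (real n)\<^sup>2" using rn by linarith
    moreover have "incr_on ?S ?Z" by (rule conn_pairs_incr) simp
    ultimately show ?case using elim(1) b assms by (smt (verit) of_nat_0_le_iff)
  qed
qed

lemma eventually_avg_touched_le:
  fixes c c' :: real
  assumes "0 < c" "c < c'"
  shows "\<forall>\<^sub>F n in sequentially. \<forall>j. real j \<le> c * real n / 2 \<longrightarrow>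
    avg (all_edges {1..n}) j (\<lambda>E. real (card (touched {1..n} E))) \<le> 11 / 10 * (1 - exp (- c')) * real n"
proof -
  define b where "b = (c + c') / 2"
  have b: "0 < b" "c < b" "b < c'" using assms by (auto simp: b_def)
  show ?thesis
    using eventually_avg_le_rnd[OF less_imp_le[OF assms(1)] b(2)] eventually_log_rate_le[OF b(1,3)]
      eventually_real_ge[of 1]
  proof eventually_elim
    case (elim n)
    let ?S = "all_edges {1..n}"
    let ?Y = "\<lambda>E. real (card (touched {1..n} E))"
    have n: "real n > 0" using elim by simp
    have "rnd ?S (b / real n) ?Y \<le> real n * surv (real n * (- ln (1 - b / real n))) 1"
      using rnd_touched_le[of "{1..n}" "b / real n"] elim b n by simp
    also have "\<dots> \<le> real n * surv c' 1"
      using elim by (intro mult_left_mono surv_mono) auto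
    also have "\<dots> = (1 - exp (- c')) * real n" by simp
    finally have "11 / 10 * rnd ?S (b / real n) ?Y \<le> 11 / 10 * ((1 - exp (- c')) * real n)"
      by (rule mult_left_mono) simp
    hence "11 / 10 * rnd ?S (b / real n) ?Y \<le> 11 / 10 * (1 - exp (- c')) * real n"
      by (simp only: mult.assoc)
    moreover have "incr_on ?S ?Y" by (rule touched_incr) simp
    ultimately show ?case using elim(1) b assms by (smt (verit) of_nat_0_le_iff)
  qed
qed

text \<open>While at least \<open>n^2/4\<close> pairs are still free, \<open>a n^2\<close> connected
  pairs mean a chance of at most \<open>4 a\<close> that the next edge joins connected
  vertices.\<close>

lemma avg_min_uncut_growth:
  assumes V: "finite V" and k: "m \<le> k" "real k + (real (card V))\<^sup>2 / 4 \<le> real (card V choose 2)"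
    and V0: "0 < card V"
    and Z: "\<And>j. m \<le> j \<Longrightarrow> j < k \<Longrightarrow>
      avg (all_edges V) j (\<lambda>E. real (card (conn_pairs V E))) \<le> a * (real (card V))\<^sup>2"
  shows "avg (all_edges V) k (\<lambda>E. real (min_uncut V E))
    \<le> avg (all_edges V) m (\<lambda>E. real (min_uncut V E)) + 4 * a * real (k - m)"
  using k Z
proof (induction k rule: dec_induct)
  case (step k)
  let ?n = "real (card V)" and ?N = "real (card V choose 2)"
  let ?z = "avg (all_edges V) k (\<lambda>E. real (card (conn_pairs V E)))"
  have n: "?n\<^sup>2 > 0" using V0 by simp
  have N: "?n\<^sup>2 / 4 \<le> ?N - real k" using step.prems by simp
  have kN: "k < card V choose 2" using N n by linarith
  have z: "0 \<le> ?z" "?z \<le> a * ?n\<^sup>2" using step.prems(2)[of k] step.hyps by (auto intro: avg_nonneg)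
  have "?z / (?N - real k) \<le> (a * ?n\<^sup>2) / (?n\<^sup>2 / 4)"
    using z N n by (intro frac_le) auto
  also have "\<dots> = 4 * a" using n by simp
  finally have "avg (all_edges V) (Suc k) (\<lambda>E. real (min_uncut V E))
      \<le> avg (all_edges V) k (\<lambda>E. real (min_uncut V E)) + 4 * a"
    using avg_min_uncut_Suc[OF V kN] by linarith
  moreover have "avg (all_edges V) k (\<lambda>E. real (min_uncut V E))
      \<le> avg (all_edges V) m (\<lambda>E. real (min_uncut V E)) + 4 * a * real (k - m)"
    using step.prems by (intro step.IH) auto
  moreover have "4 * a * real (Suc k - m) = 4 * a * real (k - m) + 4 * a"
    using step.hyps by (simp add: Suc_diff_le algebra_simps)
  ultimately show ?case by linarith
qed simp

lemma avg_0: "avg S 0 f = f {}" if "finite S"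
proof -
  have "slice S 0 = {{}}" using that by (auto simp: slice_def dest: finite_subset)
  thus ?thesis by (simp add: avg_def)
qed

lemma min_uncut_empty: "finite V \<Longrightarrow> min_uncut V {} = 0"
  using min_uncut_le[of V "{}" "{}"] by simp

lemma nat_floor_bounds:
  fixes y :: real
  assumes "0 \<le> y"
  shows "real (nat \<lfloor>y\<rfloor>) \<le> y" "y - 1 \<le> real (nat \<lfloor>y\<rfloor>)"
  using assms by (auto simp: of_nat_nat)

lemma share_mono:
  assumes "\<And>E. E \<in> slice S m \<Longrightarrow> P E \<Longrightarrow> Q E"
  shows "share S m P \<le> share S m Q"
  unfolding share_def by (rule avg_mono) (use assms in auto)

lemma share_disj_le: "share S m (\<lambda>E. P E \<or> Q E) \<le> share S m P + share S m Q"
  unfolding share_def avg_add[symmetric] by (rule avg_mono) auto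

lemma share_True: "finite S \<Longrightarrow> m \<le> card S \<Longrightarrow> share S m (\<lambda>_. True) = 1"
  unfolding share_def by (simp add: avg_const)

text \<open>The value of \<open>\<delta>\<close> is chosen so small that slightly above criticality two random vertices are
  rarely connected; hence among the last \<open>\<delta> n\<close> edges only a small proportion closes cycles.\<close>

lemma eventually_avg_max_bisection_ge:
  fixes \<delta> :: real
  assumes \<delta>: "0 < \<delta>" "\<delta> \<le> 1 / 2000000"
  shows "\<forall>\<^sub>F n in sequentially. n / 2 + 5 * \<delta> * n / 16
    \<le> avg (all_edges {1..n}) (nat \<lfloor>(1 + \<delta>) * real n / 2\<rfloor>) (\<lambda>E. real (max_bisection {1..n} E))"
proof -
  \<comment> \<open>\<open>\<epsilon>\<close> can be an absolute constant, as it is charged only to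
    the roughly \<open>\<delta> n\<close> edges of the second phase. \<open>\<theta>\<close> must be
    a small multiple of \<open>\<delta>\<close>, as it is charged to the roughly \<open>n/2\<close>
    edges of the first. The bound on \<open>\<delta>\<close> ensures
    \<open>2 * \<delta> \<le> \<epsilon> / 8\<close>, the range of
    \<open>surv_near_critical\<close>.\<close>
  define \<epsilon> :: real where "\<epsilon> = 1 / 100000"
  define \<theta> where "\<theta> = \<delta> / 10000"
  obtain r1 where r1: "(1 - \<delta> / 2) ^ r1 < \<theta>"
    using real_arch_pow_inv[of \<theta> "1 - \<delta> / 2"] \<delta> by (auto simp: \<theta>_def)
  obtain r2 where r2: "(1 - \<epsilon> / 8) ^ r2 < \<epsilon>"
    using real_arch_pow_inv[of \<epsilon> "1 - \<epsilon> / 8"] by (auto simp: \<epsilon>_def)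
  have s1: "surv (1 - \<delta> / 2) r1 < \<theta>"
    using surv_le_power[of "1 - \<delta> / 2" r1] r1 \<delta> by simp
  have s2: "surv (1 + 2 * \<delta>) r2 < 2 * \<epsilon>"
    using surv_near_critical[of \<epsilon> "1 + 2 * \<delta>" r2] r2 \<delta> by (simp add: \<epsilon>_def)
  \<comment> \<open>Together with the threshold \<open>9/10\<close> below, Markov leaves a positive
    chance of at least \<open>n/10\<close> isolated vertices; \<open>exp 1 \<le> 3\<close> is
    accurate enough for that.\<close>
  have expq: "11 / 10 * (1 - exp (- (1 + 2 * \<delta>))) \<le> 33 / 40"
  proof -
    have "exp (1 + 2 * \<delta>) = exp 1 * exp (2 * \<delta>)" by (simp add: exp_add)
    also have "\<dots> \<le> 3 * (1 + 2 * \<delta> + (2 * \<delta>)\<^sup>2)"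
      using \<delta> by (intro mult_mono exp_le exp_bound) auto
    also have "\<dots> \<le> 3 * (1 + 2 * \<delta> + 2 * \<delta> * 1)"
      unfolding power2_eq_square using \<delta> by (intro mult_left_mono add_left_mono) auto
    also have "\<dots> \<le> 4" using \<delta> by simp
    finally have "1 / 4 \<le> exp (- (1 + 2 * \<delta>))"
      unfolding exp_minus by (simp add: field_simps)
    thus ?thesis by simp
  qed
  have rates: "0 < 1 - \<delta>" "1 - \<delta> < 1 - \<delta> / 2" "0 < 1 + \<delta>" "1 + \<delta> < 1 + 2 * \<delta>"
    using \<delta> by auto
  show ?thesis
    using eventually_avg_conn_pairs_le[OF rates(1,2) s1] eventually_avg_conn_pairs_le[OF rates(3,4) s2]
      eventually_avg_touched_le[OF rates(3,4)]
      eventually_real_ge[of 1000] eventually_real_ge[of "100 / \<delta>"]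
      eventually_real_ge[of "50000 / \<delta>\<^sup>2"]
  proof eventually_elim
    case (elim n)
    let ?V = "{1..n}" let ?S = "all_edges ?V"
    let ?Z = "\<lambda>E. real (card (conn_pairs ?V E))" and ?Y = "\<lambda>E. real (card (touched ?V E))"
      and ?U = "\<lambda>E. real (min_uncut ?V E)" and ?B = "\<lambda>E. real (max_bisection ?V E)"
    define x where "x = real n"
    have x: "x \<ge> 1000" "\<delta> * x \<ge> 100" "\<delta>\<^sup>2 * x \<ge> 50000" "x > 0"
      using elim(4-6) \<delta> by (auto simp: x_def pos_divide_le_eq mult.commute)
    define m0 where "m0 = nat \<lfloor>(1 + \<delta>) * x / 2\<rfloor>"
    define m1 where "m1 = nat \<lfloor>(1 - \<delta>) * x / 2\<rfloor>"
    have m0: "real m0 \<le> (1 + \<delta>) * x / 2" "(1 + \<delta>) * x / 2 - 1 \<le> real m0"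
      using nat_floor_bounds[of "(1 + \<delta>) * x / 2"] \<delta> x by (auto simp: m0_def)
    have m1: "real m1 \<le> (1 - \<delta>) * x / 2" "(1 - \<delta>) * x / 2 - 1 \<le> real m1"
      using nat_floor_bounds[of "(1 - \<delta>) * x / 2"] \<delta> x by (auto simp: m1_def)
    have m10: "m1 \<le> m0"
      unfolding m0_def m1_def using \<delta> x by (intro nat_mono floor_mono divide_right_mono mult_right_mono) auto
    have fin: "finite ?S" "card ?S = n choose 2" by (auto simp: card_all_edges)
    have m0x: "real m0 \<le> x"
    proof -
      have "(1 + \<delta>) * x \<le> 2 * x" using \<delta> x by (intro mult_right_mono) auto
      thus ?thesis using m0 by linarith
    qed
    have xx: "1000 * x \<le> x\<^sup>2" unfolding power2_eq_square using x by (intro mult_right_mono) auto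
    have N: "real (n choose 2) = (x\<^sup>2 - x) / 2"
      by (simp add: choose_two_real x_def power2_eq_square algebra_simps)
    have big: "real m0 + x\<^sup>2 / 4 \<le> real (n choose 2)" "real m1 + x\<^sup>2 / 4 \<le> real (n choose 2)"
      using N m0x xx m10 x(1) by (auto simp: field_simps)
    have m0S: "m0 \<le> card ?S"
    proof -
      have "0 \<le> x\<^sup>2 / 4" by simp
      hence "real m0 \<le> real (n choose 2)" using big(1) by linarith
      thus ?thesis unfolding fin by simp
    qed
    have Zsub: "avg ?S j ?Z \<le> 2 * \<theta> * x\<^sup>2" if "j \<le> m1" for j
      using elim(1) that m1 unfolding x_def by (meson of_nat_le_iff order_trans)
    have Zsup: "avg ?S j ?Z \<le> 4 * \<epsilon> * x\<^sup>2" if "j \<le> m0" for j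
      using elim(2) that m0 unfolding x_def by (smt (verit) of_nat_le_iff)
    have Yavg: "avg ?S m0 ?Y \<le> 33 / 40 * x"
    proof -
      have "avg ?S m0 ?Y \<le> 11 / 10 * (1 - exp (- (1 + 2 * \<delta>))) * x"
        using elim(3) m0 unfolding x_def by blast
      also have "\<dots> \<le> 33 / 40 * x" using expq x by (intro mult_right_mono) auto
      finally show ?thesis .
    qed
    have U1: "avg ?S m1 ?U \<le> 8 * \<theta> * x"
    proof -
      have "avg ?S m1 ?U \<le> avg ?S 0 ?U + 4 * (2 * \<theta>) * real (m1 - 0)"
        using big Zsub x by (intro avg_min_uncut_growth) (auto simp: x_def)
      also have "\<dots> \<le> 8 * \<theta> * x"
        using m10 m0x fin \<delta> by (simp add: avg_0 min_uncut_empty \<theta>_def)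
      finally show ?thesis .
    qed
    have U0: "avg ?S m0 ?U \<le> 8 * \<theta> * x + 32 * \<epsilon> * (\<delta> * x)"
    proof -
      have "avg ?S m0 ?U \<le> avg ?S m1 ?U + 4 * (4 * \<epsilon>) * real (m0 - m1)"
        using big Zsup x m10 by (intro avg_min_uncut_growth) (auto simp: x_def)
      moreover have "real (m0 - m1) \<le> 2 * (\<delta> * x)"
        using m0 m1 m10 x by (simp add: of_nat_diff field_simps)
      ultimately show ?thesis using U1 by (simp add: \<epsilon>_def)
    qed
    define \<mu> where "\<mu> = avg ?S m0 ?B"
    \<comment> \<open>Four bad events have shares at most 1, 2, 92 and 3 percent, so some graph
      avoids all of them. There the bisection is large and also within
      \<open>\<delta> * x / 32\<close> of its mean, which bounds the mean itself.\<close>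
    have "x / 2 + 5 * \<delta> * x / 16 \<le> \<mu>"
    proof (rule ccontr)
      assume less: "\<not> ?thesis"
      have P1: "share ?S m0 (\<lambda>E. \<delta> * x / 8 \<le> ?U E) \<le> 1 / 100"
      proof -
        have "share ?S m0 (\<lambda>E. \<delta> * x / 8 \<le> ?U E) \<le> avg ?S m0 ?U / (\<delta> * x / 8)"
          using fin x by (intro share_markov) auto
        also have "\<dots> \<le> (8 * \<theta> * x + 32 * \<epsilon> * (\<delta> * x)) / (\<delta> * x / 8)"
          using U0 x by (intro divide_right_mono) auto
        also have "\<dots> \<le> 1 / 100"
          using x by (simp add: \<theta>_def \<epsilon>_def field_simps)
        finally show ?thesis .
      qed
      have P2: "share ?S m0 (\<lambda>E. x\<^sup>2 / 500 \<le> ?Z E) \<le> 2 / 100"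
      proof -
        have "share ?S m0 (\<lambda>E. x\<^sup>2 / 500 \<le> ?Z E) \<le> avg ?S m0 ?Z / (x\<^sup>2 / 500)"
          using fin x by (intro share_markov) auto
        also have "\<dots> \<le> (4 * \<epsilon> * x\<^sup>2) / (x\<^sup>2 / 500)"
          using Zsup[of m0] x by (intro divide_right_mono) auto
        also have "\<dots> \<le> 2 / 100" using x by (simp add: \<epsilon>_def)
        finally show ?thesis .
      qed
      have P3: "share ?S m0 (\<lambda>E. 9 / 10 * x \<le> ?Y E) \<le> 92 / 100"
      proof -
        have "share ?S m0 (\<lambda>E. 9 / 10 * x \<le> ?Y E) \<le> avg ?S m0 ?Y / (9 / 10 * x)"
          using fin x by (intro share_markov) auto
        also have "\<dots> \<le> (33 / 40 * x) / (9 / 10 * x)"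
          using Yavg x by (intro divide_right_mono) auto
        also have "\<dots> \<le> 92 / 100" using x by simp
        finally show ?thesis .
      qed
      have P4: "share ?S m0 (\<lambda>E. \<delta> * x / 32 \<le> \<bar>?B E - \<mu>\<bar>) \<le> 3 / 100"
      proof -
        have "share ?S m0 (\<lambda>E. \<delta> * x / 32 \<le> \<bar>?B E - \<mu>\<bar>) \<le> real m0 * 1\<^sup>2 / (\<delta> * x / 32)\<^sup>2"
          unfolding \<mu>_def using fin x m0S
          by (intro share_chebyshev max_bisection_swap_lipschitz) auto
        also have "\<dots> \<le> x / (\<delta> * x / 32)\<^sup>2"
          using m0x by (intro divide_right_mono) auto
        also have "\<dots> = 1024 / (\<delta>\<^sup>2 * x)" using x \<delta> by (simp add: power2_eq_square field_simps)
        also have "\<dots> \<le> 1024 / 50000" using x by (intro divide_left_mono) auto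
        finally show ?thesis by simp
      qed
      have cover: "\<delta> * x / 8 \<le> ?U E \<or> x\<^sup>2 / 500 \<le> ?Z E \<or> 9 / 10 * x \<le> ?Y E
          \<or> \<delta> * x / 32 \<le> \<bar>?B E - \<mu>\<bar>" if E: "E \<in> slice ?S m0" for E
      proof (rule ccontr)
        assume "\<not> ?thesis"
        hence neg: "?U E < \<delta> * x / 8" "?Z E < x\<^sup>2 / 500" "?Y E < 9 / 10 * x" "\<bar>?B E - \<mu>\<bar> < \<delta> * x / 32"
          by linarith+
        \<comment> \<open>\<open>L (L - 1)\<close> is close to \<open>x^2 / 400\<close>, above the
          threshold \<open>x^2 / 500\<close> for connected pairs, and \<open>L\<close> plus the
          \<open>9/10 * x\<close> touched vertices still stays below \<open>x\<close>.\<close>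
        define L where "L = nat \<lfloor>x / 20\<rfloor>"
        have L: "real L \<le> x / 20" "x / 20 - 1 \<le> real L" using nat_floor_bounds[of "x / 20"] x by (auto simp: L_def)
        have L1: "1 \<le> L" using L x by linarith
        have "x\<^sup>2 / 500 \<le> (x / 20 - 1) * (x / 20 - 2)"
        proof -
          have "(x / 20 - 1) * (x / 20 - 2) = x\<^sup>2 / 400 - 3 * x / 20 + 2"
            by (simp add: power2_eq_square algebra_simps)
          thus ?thesis using xx x(4) by linarith
        qed
        also have "\<dots> \<le> real L * (real L - 1)" using L x by (intro mult_mono) auto
        also have "\<dots> = real (L * (L - 1))" using L1 by (simp add: of_nat_diff)
        finally have "real (card (conn_pairs ?V E)) < real (L * (L - 1))" using neg by linarith
        hence "card (conn_pairs ?V E) < L * (L - 1)" by (simp only: of_nat_less_iff)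
        moreover have "L + card (touched ?V E) \<le> card ?V"
        proof -
          have "real (L + card (touched ?V E)) \<le> real n" using L neg by (simp add: x_def)
          thus ?thesis by simp
        qed
        ultimately have "card E \<le> max_bisection ?V E + min_uncut ?V E"
          using E by (intro max_bisection_ge_uncut) (auto simp: slice_def)
        hence "real m0 \<le> ?B E + ?U E" using E by (simp add: slice_def flip: of_nat_add)
        \<comment> \<open>Of the \<open>16/32\<close> of \<open>\<delta> * x\<close> available, 4 go
          to uncut edges, 1 to the deviation from the mean and 1 to rounding, as
          \<open>\<delta> * x \<ge> 100\<close>; the claimed \<open>10/32\<close> remain.\<close>
        hence "(1 + \<delta>) * x / 2 - 1 - \<delta> * x / 8 - \<delta> * x / 32 < \<mu>"
          using neg m0 by linarith
        thus False using less x by (simp add: field_simps)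
      qed
      have "1 = share ?S m0 (\<lambda>_. True)" using fin m0S by (simp add: share_True)
      also have "\<dots> \<le> share ?S m0 (\<lambda>E. \<delta> * x / 8 \<le> ?U E \<or> x\<^sup>2 / 500 \<le> ?Z E \<or> 9 / 10 * x \<le> ?Y E
          \<or> \<delta> * x / 32 \<le> \<bar>?B E - \<mu>\<bar>)" by (rule share_mono) (rule cover)
      also have "\<dots> \<le> share ?S m0 (\<lambda>E. \<delta> * x / 8 \<le> ?U E) + (share ?S m0 (\<lambda>E. x\<^sup>2 / 500 \<le> ?Z E)
          + (share ?S m0 (\<lambda>E. 9 / 10 * x \<le> ?Y E) + share ?S m0 (\<lambda>E. \<delta> * x / 32 \<le> \<bar>?B E - \<mu>\<bar>)))"
        by (intro order_trans[OF share_disj_le] add_left_mono order_refl)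
      finally show False using P1 P2 P3 P4 by linarith
    qed
    thus ?case by (simp add: x_def \<mu>_def m0_def)
  qed
qed

section \<open>From the complement back to the random graph\<close>

lemma prob_gnm_ge_share:
  assumes m: "m \<le> n choose 2"
    and bad: "\<And>E. E \<subseteq> all_edges {1..n} \<Longrightarrow> card E = m \<Longrightarrow> E \<notin> A \<Longrightarrow> Q (all_edges {1..n} - E)"
  shows "1 - share (all_edges {1..n}) ((n choose 2) - m) Q \<le> measure_pmf.prob (gnm n m) A"
proof -
  let ?S = "all_edges {1..n}" and ?M = "(n choose 2) - m"
  have S: "finite ?S" "card ?S = n choose 2" by (auto simp: card_all_edges)
  have g: "gnm n m = pmf_of_set (slice ?S m)" by (simp add: gnm_def slice_def)
  have cs: "card (slice ?S m) = (n choose 2) choose m" "card (slice ?S ?M) = (n choose 2) choose m"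
    using card_slice[OF S(1)] S(2) binomial_symmetric[OF m] by auto
  have pos: "real ((n choose 2) choose m) > 0" using m by simp
  hence "card (slice ?S m) \<noteq> 0" using cs by linarith
  hence ne: "slice ?S m \<noteq> {}" by (metis card.empty)
  have "card (slice ?S m - A) \<le> card {H \<in> slice ?S ?M. Q H}"
  proof (rule card_inj_on_le[of "\<lambda>E. ?S - E"])
    show "inj_on (\<lambda>E. ?S - E) (slice ?S m - A)"
      by (auto simp: inj_on_def slice_def double_diff)
    show "(\<lambda>E. ?S - E) ` (slice ?S m - A) \<subseteq> {H \<in> slice ?S ?M. Q H}"
    proof clarify
      fix E assume E: "E \<in> slice ?S m" "E \<notin> A"
      hence E': "E \<subseteq> ?S" "card E = m" by (auto simp: slice_def)
      have "card (?S - E) = ?M"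
        using E' S finite_subset[OF E'(1) S(1)] by (simp add: card_Diff_subset)
      thus "?S - E \<in> slice ?S ?M \<and> Q (?S - E)" using bad[OF E' E(2)] by (auto simp: slice_def)
    qed
  qed (use S in auto)
  hence le: "real (card (slice ?S m - A)) \<le> real (card {H \<in> slice ?S ?M. Q H})" by simp
  have sh: "share ?S ?M Q = real (card {H \<in> slice ?S ?M. Q H}) / real ((n choose 2) choose m)"
    unfolding share_def avg_def using S binomial_symmetric[OF m]
    by (subst sum_of_bool_card) auto
  have "card (slice ?S m \<inter> A) + card (slice ?S m - A) = card (slice ?S m)"
    using S card_Int_Diff[of "slice ?S m" A] by simp
  hence "real (card (slice ?S m \<inter> A)) = real ((n choose 2) choose m) - real (card (slice ?S m - A))"
    using cs by linarith
  moreover have "measure_pmf.prob (gnm n m) A = real (card (slice ?S m \<inter> A)) / real ((n choose 2) choose m)"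
    unfolding g cs(1)[symmetric] using ne S by (subst measure_pmf_of_set) auto
  ultimately have "measure_pmf.prob (gnm n m) A
      = 1 - real (card (slice ?S m - A)) / real ((n choose 2) choose m)"
    using pos by (simp add: diff_divide_distrib)
  thus ?thesis unfolding sh using divide_right_mono[OF le, of "real ((n choose 2) choose m)"] by simp
qed

theorem theorem1p6:
  fixes c\<^sub>1 c\<^sub>2 :: real
  assumes "1 < c\<^sub>1" and "c\<^sub>1 < c\<^sub>2"
  shows "\<exists>\<alpha> \<beta> :: real. 0 < \<alpha> \<and> \<alpha> < \<beta> \<and>
    (\<forall>m :: nat \<Rightarrow> nat.
      (\<forall>\<^sub>F n in sequentially.
         real (n choose 2) - c\<^sub>2 * real n / 2 \<le> real (m n) \<and>
         real (m n) \<le> real (n choose 2) - c\<^sub>1 * real n / 2) \<longrightarrow>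
      (\<lambda>n. measure_pmf.prob (gnm n (m n))
         {E. \<alpha> / real n \<le> max_modularity {1..n} E \<and>
             max_modularity {1..n} E \<le> \<beta> / real n}) \<longlonglongrightarrow> 1)"
proof -
  define \<delta> where "\<delta> = min (c\<^sub>1 - 1) (1 / 2000000)"
  have \<delta>: "0 < \<delta>" "\<delta> \<le> 1 / 2000000" "1 + \<delta> \<le> c\<^sub>1"
    unfolding \<delta>_def using assms by linarith+
  define C where "C = c\<^sub>2"
  have C: "1 < C" using assms by (simp add: C_def)
  have main: "(\<lambda>n. measure_pmf.prob (gnm n (m n))
         {E. (\<delta> / 32) / real n \<le> max_modularity {1..n} E \<and>
             max_modularity {1..n} E \<le> (8 * C) / real n}) \<longlonglongrightarrow> 1"
    if mm: "\<forall>\<^sub>F n in sequentially. real (n choose 2) - c\<^sub>2 * real n / 2 \<le> real (m n) \<and>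
         real (m n) \<le> real (n choose 2) - c\<^sub>1 * real n / 2" for m :: "nat \<Rightarrow> nat"
  proof (rule tendsto_sandwich)
    show "(\<lambda>n. 1 - (2048 * C / \<delta>\<^sup>2) / real n) \<longlonglongrightarrow> 1"
      using tendsto_diff[OF tendsto_const[of 1] lim_const_over_n[of "2048 * C / \<delta>\<^sup>2"]] by simp
    show "\<forall>\<^sub>F n in sequentially. measure_pmf.prob (gnm n (m n))
         {E. (\<delta> / 32) / real n \<le> max_modularity {1..n} E \<and>
             max_modularity {1..n} E \<le> (8 * C) / real n} \<le> 1"
      by simp
    show "\<forall>\<^sub>F n in sequentially. 1 - (2048 * C / \<delta>\<^sup>2) / real n \<le> measure_pmf.prob (gnm n (m n))
         {E. (\<delta> / 32) / real n \<le> max_modularity {1..n} E \<and>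
             max_modularity {1..n} E \<le> (8 * C) / real n}"
      using mm eventually_avg_max_bisection_ge[OF \<delta>(1,2)] eventually_real_ge[of "100 * C"]
        eventually_real_ge[of "64 * C\<^sup>2 / \<delta>"] eventually_real_ge[of "64 * (1 + C)\<^sup>2 / \<delta>"]
    proof eventually_elim
      case (elim n)
      let ?V = "{1..n}" let ?S = "all_edges ?V"
      let ?B = "\<lambda>E. real (max_bisection ?V E)"
      define x where "x = real n"
      define N where "N = real (n choose 2)"
      define M where "M = (n choose 2) - m n"
      define m0 where "m0 = nat \<lfloor>(1 + \<delta>) * x / 2\<rfloor>"
      have x: "x \<ge> 100 * C" "64 * C\<^sup>2 \<le> \<delta> * x" "64 * (1 + C)\<^sup>2 \<le> \<delta> * x" "x > 0" "x \<ge> 100"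
        using elim(3-5) \<delta> C by (auto simp: x_def pos_divide_le_eq mult.commute)
      have N: "N = (x\<^sup>2 - x) / 2"
        by (simp add: N_def x_def choose_two_real power2_eq_square algebra_simps)
      have xx: "100 * x \<le> x\<^sup>2" "100 * (C * x) \<le> x\<^sup>2"
        using mult_right_mono[OF x(5), of x] mult_right_mono[OF x(1), of x] x(4)
        by (auto simp: power2_eq_square)
      have fin: "finite ?S" "card ?S = n choose 2" by (auto simp: card_all_edges)
      have "real (m n) \<le> N - c\<^sub>1 * x / 2" "0 \<le> c\<^sub>1 * x / 2"
        using elim(1) x assms by (auto simp: N_def x_def)
      hence "real (m n) \<le> N" by linarith
      hence mn: "m n \<le> n choose 2" by (simp add: N_def)
      have M: "real M = N - real (m n)" using mn by (simp add: M_def N_def of_nat_diff)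
      have Mb: "c\<^sub>1 * x / 2 \<le> real M" "real M \<le> C * x / 2"
        using elim(1) unfolding M by (auto simp: N_def x_def C_def)
      have m0: "real m0 \<le> (1 + \<delta>) * x / 2" using nat_floor_bounds[of "(1 + \<delta>) * x / 2"] \<delta> x by (simp add: m0_def)
      have "(1 + \<delta>) * x \<le> c\<^sub>1 * x" using \<delta> x by (intro mult_right_mono) auto
      hence m0M: "m0 \<le> M" using m0 Mb by linarith
      have MN: "2 * real M < N" using Mb xx x by (simp add: N field_simps)
      hence MN': "2 * M < card ?V choose 2" by (simp add: N_def)
      have Npos: "N > 0" using MN by linarith
      define \<mu> where "\<mu> = avg ?S M ?B"
      have drift: "x / 2 + 5 * \<delta> * x / 16 + (real M - real m0) * (1 / 2 - real M / N) \<le> \<mu>"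
        using avg_max_bisection_mono[OF _ m0M MN'] elim(2) m0M
        by (simp add: \<mu>_def m0_def x_def N_def of_nat_diff)
      \<comment> \<open>The total error of the steps from \<open>m0\<close> to \<open>M\<close> is
        at most \<open>M^2 / N\<close>. With \<open>M\<close> linear and \<open>N\<close> quadratic
        in \<open>x\<close> this stays bounded, hence negligible against the surplus of order
        \<open>\<delta> * x\<close>.\<close>
      have slope: "(real M - real m0) / 2 - C\<^sup>2 \<le> (real M - real m0) * (1 / 2 - real M / N)"
      proof -
        have "(real M - real m0) * real M \<le> real M * real M" by (intro mult_right_mono) auto
        also have "\<dots> \<le> (C * x / 2) * (C * x / 2)" using Mb by (intro mult_mono) auto
        also have "\<dots> = C\<^sup>2 * (x\<^sup>2 / 4)" by (simp add: power2_eq_square)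
        also have "\<dots> \<le> C\<^sup>2 * N" using xx x by (intro mult_left_mono) (auto simp: N)
        finally have "(real M - real m0) * real M / N \<le> C\<^sup>2" using Npos by (simp add: pos_divide_le_eq)
        thus ?thesis by (simp add: right_diff_distrib)
      qed
      \<comment> \<open>Half of \<open>m0\<close> is at most \<open>x/4 + \<delta> * x / 4\<close>,
        so of \<open>5 * \<delta> * x / 16\<close> a surplus of \<open>\<delta> * x / 16\<close>
        over \<open>M/2 + x/4\<close> is left.\<close>
      have \<mu>: "real M / 2 + x / 4 + \<delta> * x / 16 - C\<^sup>2 \<le> \<mu>"
      proof -
        have "x / 2 + 5 * \<delta> * x / 16 + ((real M - real m0) / 2 - C\<^sup>2) \<le> \<mu>"
          using drift slope by linarith
        thus ?thesis using m0 by (simp add: field_simps)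
      qed
      have ev: "share ?S M (\<lambda>E. \<delta> * x / 64 \<le> \<bar>?B E - \<mu>\<bar>) \<le> (2048 * C / \<delta>\<^sup>2) / x"
      proof -
        have "share ?S M (\<lambda>E. \<delta> * x / 64 \<le> \<bar>?B E - \<mu>\<bar>) \<le> real M * 1\<^sup>2 / (\<delta> * x / 64)\<^sup>2"
          unfolding \<mu>_def using fin x \<delta>
          by (intro share_chebyshev max_bisection_swap_lipschitz) (auto simp: M_def)
        also have "\<dots> \<le> (C * x / 2) / (\<delta> * x / 64)\<^sup>2" using Mb by (intro divide_right_mono) auto
        also have "\<dots> = (2048 * C / \<delta>\<^sup>2) / x" using x \<delta> by (simp add: power2_eq_square field_simps)
        finally show ?thesis .
      qed
      have good: "(\<delta> / 32) / x \<le> max_modularity ?V E \<and> max_modularity ?V E \<le> (8 * C) / x"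
        if E: "E \<subseteq> ?S" "card E = m n" and ok: "\<bar>?B (?S - E) - \<mu>\<bar> < \<delta> * x / 64" for E
      proof -
        define k where "k = real (card E)"
        have cH: "card (?S - E) = M"
          using E fin finite_subset[OF E(1) fin(1)] by (simp add: card_Diff_subset M_def)
        have k: "k = N - real M" using E M by (simp add: k_def)
        have kb: "x\<^sup>2 / 4 \<le> k" "k \<le> x\<^sup>2 / 2" using Mb xx x unfolding k N by (auto simp: field_simps)
        have "0 < x\<^sup>2 / 4" using x by simp
        hence kpos: "k > 0" using kb by linarith
        hence E0: "0 < card E" by (simp add: k_def)
        \<comment> \<open>At least \<open>x/2\<close> edges are missing, so
          \<open>2 k \<le> x^2 - 2 x\<close>, which is below \<open>(x - 1)^2\<close>.\<close>
        have "x \<le> c\<^sub>1 * x" using assms x by simp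
        hence dense: "2 * real (card E) \<le> (real (card ?V) - 1)\<^sup>2"
          using Mb k N by (simp add: k_def x_def power2_eq_square algebra_simps)
        have "max_modularity ?V E \<le> x\<^sup>2 * real M / k\<^sup>2"
          using max_modularity_le[OF _ E(1) E0 dense] unfolding x_def k_def cH[symmetric] by simp
        also have "\<dots> \<le> x\<^sup>2 * (C * x / 2) / (x\<^sup>2 / 4)\<^sup>2"
          using Mb kb x by (intro frac_le mult_left_mono power_mono) auto
        also have "\<dots> = (8 * C) / x" using x by (simp add: power2_eq_square field_simps)
        finally have up: "max_modularity ?V E \<le> (8 * C) / x" .
        \<comment> \<open>\<open>C^2\<close> and the deviation from the mean each take at most
          \<open>\<delta> * x / 64\<close> of the surplus. Dividing the remaining half by
          \<open>k \<le> x^2 / 2\<close> gives twice the desired bound, and the volume term below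
          consumes at most one of the two shares.\<close>
        have "\<delta> * x / 32 \<le> ?B (?S - E) - real M / 2 - x / 4"
          using ok \<mu> x by linarith
        hence "(\<delta> * x / 32) / (x\<^sup>2 / 2) \<le> (?B (?S - E) - real M / 2 - x / 4) / k"
        proof (intro frac_le)
          have "0 \<le> \<delta> * x / 32" using \<delta> x by simp
          thus "0 \<le> ?B (?S - E) - real M / 2 - x / 4"
            using \<open>\<delta> * x / 32 \<le> ?B (?S - E) - real M / 2 - x / 4\<close> by linarith
        qed (use kb kpos in auto)
        moreover have "(x + 2 * real M)\<^sup>2 / (8 * k\<^sup>2) \<le> ((1 + C) * x)\<^sup>2 / (8 * (x\<^sup>2 / 4)\<^sup>2)"
          using Mb kb x C by (intro frac_le power_mono mult_left_mono) (auto simp: algebra_simps)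
        moreover have "((1 + C) * x)\<^sup>2 / (8 * (x\<^sup>2 / 4)\<^sup>2) \<le> (\<delta> / 32) / x"
        proof -
          have "((1 + C) * x)\<^sup>2 / (8 * (x\<^sup>2 / 4)\<^sup>2) = (64 * (1 + C)\<^sup>2) / (32 * x\<^sup>2)"
            using x by (simp add: power2_eq_square field_simps)
          also have "\<dots> \<le> (\<delta> * x) / (32 * x\<^sup>2)" using x by (intro divide_right_mono) auto
          also have "\<dots> = (\<delta> / 32) / x" using x by (simp add: power2_eq_square)
          finally show ?thesis .
        qed
        moreover have "(\<delta> * x / 32) / (x\<^sup>2 / 2) = 2 * ((\<delta> / 32) / x)"
          using x by (simp add: power2_eq_square)
        moreover have "(?B (?S - E) - real M / 2 - x / 4) / k - (x + 2 * real M)\<^sup>2 / (8 * k\<^sup>2) \<le> max_modularity ?V E"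
          using max_modularity_ge[OF _ _ E(1) E0] x unfolding x_def k_def cH[symmetric] by simp
        ultimately have "(\<delta> / 32) / x \<le> max_modularity ?V E" by linarith
        thus ?thesis using up by simp
      qed
      have "1 - share ?S M (\<lambda>E. \<delta> * x / 64 \<le> \<bar>?B E - \<mu>\<bar>) \<le> measure_pmf.prob (gnm n (m n))
         {E. (\<delta> / 32) / x \<le> max_modularity ?V E \<and> max_modularity ?V E \<le> (8 * C) / x}"
        unfolding M_def by (rule prob_gnm_ge_share[OF mn]) (use good in \<open>force simp: M_def\<close>)
      thus ?case using ev by (simp add: x_def)
    qed
  qed simp
  show ?thesis
  proof (intro exI conjI allI impI)
    show "0 < \<delta> / 32" "\<delta> / 32 < 8 * C" using \<delta> C by auto
  qed (use main in auto)
qed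

end
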